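(* Let $w\in\mathbb{D}$, $\alpha\in\mathbb{H}$, and let $\widetilde X_1,\widetilde X_2,\dots$ be i.i.d. random variables with the circular Cauchy distribution $P^{\mathrm{cc}}_w$. Let $X_n=\phi_\alpha^{-1}(\exp(i\widetilde X_n))$, let $f$ be an admissible generator (see context) such that $E[\exp(\lambda|f(X_1)|)]<+\infty$ for some constant $\lambda>0$, let $Y_n=f^{-1}\left(\frac1n\sum_{j=1}^n f(X_j)\right)$, \[ Z_n=Y_n+\frac{2\,\mathrm{Im}(Y_n)\,i}{n}\sum_{j=1}^n\frac{X_j-Y_n}{X_j-\overline{Y_n}}, \] and $W_n=\phi_\alpha(Z_n)$. Then \[ \limsup_{n\to\infty}n\,\mathrm{Var}(W_n)\le\lim_{n\to\infty}n\,E\left[|W_n-w|^2\right]=\left(1-|w|^2\right)^2. \]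
   Context: $\mathbb{D}=\{z\in\mathbb{C}:|z|<1\}$, $\mathbb{H}=\{z\in\mathbb{C}:\mathrm{Im}(z)>0\}$, $\overline{\mathbb{H}}=\mathbb{H}\cup\mathbb{R}$. For a complex-valued random variable $T$, $\mathrm{Var}(T)=E[|T-E[T]|^2]$. For $w\in\mathbb{D}$, the circular Cauchy distribution $P^{\mathrm{cc}}_w$ is the distribution on $[0,2\pi)$ with density $p^{\mathrm{cc}}(x;w)=\frac{1}{2\pi}\frac{1-|w|^2}{|\exp(ix)-w|^2}$. $\phi_\alpha:\mathbb{H}\to\mathbb{D}$, $\phi_\alpha(z)=\frac{z-\alpha}{z-\overline\alpha}$, is a bijection with inverse $\phi_\alpha^{-1}(w)=\frac{\alpha-\overline\alpha w}{1-w}$; the latter formula is also used for $|w|=1$, $w\neq1$, where it gives real values. The $X_n$ are i.i.d. with the Cauchy distribution with parameter $\phi_\alpha^{-1}(w)=\mu+\sigma i\in\mathbb{H}$, i.e. with density $\frac{\sigma}{\pi}\frac{1}{(x-\mu)^2+\sigma^2}$ on $\mathbb{R}$. Admissible generator: a function $f:U\to\mathbb{C}$ for which there is a point $a\in\mathbb{C}$ with $\mathrm{Im}(a)\le 0$ such that $U\subset\mathbb{C}$ is a domain containing $\overline{\mathbb{H}}\setminus\{a\}$, $f$ is continuous, injective and holomorphic on $U$, the set $f(\overline{\mathbb{H}}\setminus\{a\})$ is convex, $\lim_{z\to a}(z-a)f(z)=0$, and $\lim_{|z|\to\infty}f(z)/|z|=0$.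
   Formalization: Since Z_n can leave ℍ with positive probability, where φ_α is not defined (its formula has a pole at the conjugate of α), W_n is any random variable equal to φ_α(Z_n) when Z_n ∈ ℍ and with arbitrary values in the closed unit disc otherwise. *)

theory Defs
  imports "HOL-Probability.Probability" "HOL-Complex_Analysis.Complex_Analysis"
begin

definition upper_half_plane :: "complex set" where
  "upper_half_plane = {z. 0 < Im z}"

definition closed_upper_half_plane :: "complex set" where
  "closed_upper_half_plane = {z. 0 \<le> Im z}"

definition cvariance :: "'a measure \<Rightarrow> ('a \<Rightarrow> complex) \<Rightarrow> real" where
  "cvariance M T = (\<integral>\<omega>. (cmod (T \<omega> - (\<integral>\<omega>'. T \<omega>' \<partial>M)))\<^sup>2 \<partial>M)"

text \<open>Extended by zero outside the period interval, so that it is a density on the whole line.\<close>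

definition circular_cauchy_density :: "complex \<Rightarrow> real \<Rightarrow> real" where
  "circular_cauchy_density w x =
     indicator {0..<2 * pi} x * ((1 / (2 * pi)) * ((1 - (cmod w)\<^sup>2) / (cmod (cis x - w))\<^sup>2))"

text \<open>The bijection from the upper half plane onto the unit disc. The formula must only be used for
  arguments in the upper half plane: below the real axis it is unbounded, with a pole at \<open>cnj \<alpha>\<close>.
  The one-step estimator \<open>Z n\<close> can leave the upper half plane with positive (though exponentially small)
  probability, and applying the bare formula there can make the second moment infinite. So the
  transformed estimator \<open>W n\<close> is taken to be any random variable that agrees with
  \<open>cayley \<alpha> (Z n)\<close> where \<open>Z n\<close> is in the upper half plane, and is an arbitrary point of the
  closed unit disc elsewhere.\<close>

definition cayley :: "complex \<Rightarrow> complex \<Rightarrow> complex" where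
  "cayley \<alpha> z = (z - \<alpha>) / (z - cnj \<alpha>)"

text \<open>On the unit circle without \<open>1\<close> the values are real; the value at \<open>1\<close>
  is irrelevant, being taken with probability zero.\<close>

definition cayley_inv :: "complex \<Rightarrow> complex \<Rightarrow> complex" where
  "cayley_inv \<alpha> w = (\<alpha> - cnj \<alpha> * w) / (1 - w)"

text \<open>The function is only meaningful on \<open>U\<close>, so both limits are taken along \<open>U\<close>.
  The exceptional point \<open>a\<close> may or may not belong to \<open>U\<close>.\<close>

definition admissible_generator :: "complex set \<Rightarrow> (complex \<Rightarrow> complex) \<Rightarrow> bool" where
  "admissible_generator U f \<longleftrightarrow>
     open U \<and> connected U \<and>
     continuous_on U f \<and> inj_on f U \<and> f holomorphic_on U \<and>
     (\<exists>a. Im a \<le> 0 \<and>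
          closed_upper_half_plane - {a} \<subseteq> U \<and>
          convex (f ` (closed_upper_half_plane - {a})) \<and>
          ((\<lambda>z. (z - a) * f z) \<longlongrightarrow> 0) (at a within U) \<and>
          ((\<lambda>z. f z / of_real (cmod z)) \<longlongrightarrow> 0) (inf at_infinity (principal U)))"

end

theory Submission
  imports Defs
begin

text \<open>
  Put \<open>\<gamma> = cayley_inv \<alpha> w\<close> and \<open>S\<^sub>j = cayley \<gamma> (X\<^sub>j)\<close>, so that \<open>|S\<^sub>j| = 1\<close>. For \<open>g\<close> holomorphic on the upper
  half plane with at most mild boundary singularities, \<open>E g(X\<^sub>1) = g(\<gamma>)\<close>; hence \<open>f(X\<^sub>1) - f(\<gamma>)\<close>, \<open>S\<^sub>1\<close>
  and \<open>S\<^sub>1\<^sup>2\<close> are centred. Let \<open>D\<close>, \<open>m\<^sub>1\<close>, \<open>m\<^sub>2\<close> be their sample means and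
  \<open>Q = |D|\<^sup>2 + |m\<^sub>1|\<^sup>2 + |m\<^sub>2|\<^sup>2\<close>; bounding fourth moments of sums of independent variables gives
  \<open>E Q\<^sup>2 = O(1/n\<^sup>2)\<close>. One Newton-like step from \<open>Y\<close> removes the error \<open>Y - \<gamma>\<close> to first order, and
  what is left is \<open>W - w = \<kappa> m\<^sub>1 + O(Q)\<close> with \<open>|\<kappa>| = 1 - |w|\<^sup>2\<close>. As \<open>W\<close> is bounded, this estimate is
  trivially true where \<open>Q\<close> is not small, so it holds at every sample point and no exceptional event has to be
  split off. Since \<open>E |m\<^sub>1|\<^sup>2 = 1/n\<close>, the limit follows. The variance is at most the second moment about any
  other point.
\<close>

section \<open>Mean values under the circular Cauchy distribution\<close>

text \<open>The obstacle is that \<open>Y\<close> is controlled only through a local inverse of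
  \<open>f\<close>, whereas a second moment sees every sample point. Hence the aim is a
  deterministic inequality whose constant depends neither on n nor on the sample, with an error
  measured by a quantity whose moments are explicit. The square of S enters as follows. With e the
  conjugate of y - g, the ratio (x - g) / (x - cnj y) equals S + e (S - S^2) / (g - cnj g) +
  O(|e|^2). Averaging turns the linear term into a multiple of e (m1 - m2), a product of two small
  quantities, because S and S^2 are both centred. The growth conditions on \<open>f\<close> say
  that, after transport to the disc, it is o(1/|z - b|) at two boundary points, the images of the
  real singularity and of infinity. One linear factor per point therefore restores continuity. The
  exponential moment enters through the fourth moment of \<open>f (X 1)\<close>, which the bound on
  E Q^2 requires. The cross term E(|m1| Q) is then of order n^(-3/2), negligible against
  1/n.\<close>

lemma cis_eq_iff_interval:
  assumes "x \<in> {0..<2*pi}" "y \<in> {0..<2*pi}" "cis x = cis y"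
  shows "x = y"
  using assms by (metis Arg2pi_unique[of 1 _ "cis y"] Arg2pi_unique[of 1 _ "cis x"] atLeastLessThan_iff cis_conv_exp mult_1 of_real_1 zero_less_one)

text \<open>On the unit circle the conjugate of \<zeta> is 1/\<zeta>, so |\<zeta> - w|^2 = (\<zeta>
  - w)(1 - cnj w \<zeta>)/\<zeta> and the Poisson integral is a Cauchy integral. This is the regular
  case, from which singular integrands are reached by a limit; \<open>has_bochner_integral\<close>
  gives integrability together with the value.\<close>

lemma Poisson_circular_cauchy:
  fixes F :: "complex \<Rightarrow> complex"
  assumes cont: "continuous_on (cball 0 1) F" and hol: "F holomorphic_on ball 0 1"
    and w: "cmod w < 1"
  shows "has_bochner_integral lborel (\<lambda>x. circular_cauchy_density w x *\<^sub>R F (cis x)) (F w)"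
proof -
  have nz: "1 - cnj w * u \<noteq> 0" if "cmod u \<le> 1" for u
  proof
    assume "1 - cnj w * u = 0"
    then have "cmod w * cmod u = 1" by (metis complex_mod_cnj eq_iff_diff_eq_0 norm_mult norm_one)
    with w that show False by (smt (verit) mult_left_le norm_ge_zero)
  qed
  \<comment> \<open>On the unit circle, \<open>\<zeta> G(\<zeta>) / (\<zeta> - w)\<close> is \<open>F(\<zeta>)\<close> times the Poisson kernel, and \<open>G w = F w\<close>.\<close>
  define G where "G u = F u * of_real (1 - (cmod w)\<^sup>2) / (1 - cnj w * u)" for u
  define k where "k t = (1 / (2 * pi)) * ((1 - (cmod w)\<^sup>2) / (cmod (cis t - w))\<^sup>2)" for t
  have ne: "cis t \<noteq> w" for t using w by auto
  have contG: "continuous_on (cball 0 1) G" unfolding G_def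
    by (intro continuous_intros cont) (use nz in auto)
  have holG: "G holomorphic_on ball 0 1" unfolding G_def
    by (intro holomorphic_intros hol) (use nz in auto)
  have "((\<lambda>u. G u/(u-w)) has_contour_integral (2 * of_real pi * \<i> * G w)) (circlepath 0 1)"
    by (rule Cauchy_integral_circlepath[OF contG holG]) (use w in auto)
  then have "((\<lambda>t. G (cis t) / (cis t - w) * \<i> * cis t) has_integral 2 * of_real pi * \<i> * G w) {0..2*pi}"
    unfolding circlepath_def by (subst (asm) has_contour_integral_part_circlepath_iff) auto
  from has_integral_mult_right[OF this, of "1 / (2 * of_real pi * \<i>)"]
  have "((\<lambda>t. 1 / (2 * of_real pi * \<i>) * (G (cis t) / (cis t - w) * \<i> * cis t)) has_integral G w) {0..2*pi}"
    by simp
  moreover have "1 / (2 * of_real pi * \<i>) * (G (cis t) / (cis t - w) * \<i> * cis t) = k t *\<^sub>R F (cis t)" for t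
  proof -
    have "of_real ((cmod (cis t - w))\<^sup>2) = (cis t - w) * (cnj (cis t) - cnj w)"
      by (metis complex_cnj_diff complex_norm_square)
    moreover have "cnj (cis t) = 1 / cis t" by (simp add: cis_cnj flip: cis_inverse) (simp add: divide_inverse)
    ultimately have "of_real ((cmod (cis t - w))\<^sup>2) * cis t = (cis t - w) * (1 - cnj w * cis t)"
      by (simp add: field_simps)
    moreover have "cis t - w \<noteq> 0" "1 - cnj w * cis t \<noteq> 0" "of_real ((cmod (cis t - w))\<^sup>2) \<noteq> (0::complex)"
      using ne nz[of "cis t"] by auto
    ultimately have "cis t / ((cis t - w) * (1 - cnj w * cis t)) = 1 / of_real ((cmod (cis t - w))\<^sup>2)"
      by (simp add: divide_simps mult.commute)
    then have "(F (cis t) * of_real (1 - (cmod w)\<^sup>2)) * (cis t / ((cis t - w) * (1 - cnj w * cis t)))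
       = (F (cis t) * of_real (1 - (cmod w)\<^sup>2)) * (1 / of_real ((cmod (cis t - w))\<^sup>2))" by (rule arg_cong)
    then have "(G (cis t) / (cis t - w)) * cis t = F (cis t) * of_real (1 - (cmod w)\<^sup>2) / of_real ((cmod (cis t - w))\<^sup>2)"
      unfolding G_def by (simp add: mult_ac)
    moreover have "1 / (2 * of_real pi * \<i>) * (G (cis t) / (cis t - w) * \<i> * cis t)
       = 1 / (2 * of_real pi) * ((G (cis t) / (cis t - w)) * cis t)" by (simp add: divide_simps)
    ultimately show ?thesis by (simp add: k_def scaleR_conv_of_real)
  qed
  moreover have "G w = F w"
  proof -
    have "1 - cnj w * w = of_real (1 - (cmod w)\<^sup>2)"
      by (metis complex_norm_square mult.commute of_real_1 of_real_diff)
    moreover have "of_real (1 - (cmod w)\<^sup>2) \<noteq> (0::complex)" using w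
      by (metis abs_norm_cancel abs_square_less_1 eq_iff_diff_eq_0 less_irrefl of_real_eq_0_iff)
    ultimately show ?thesis unfolding G_def by simp
  qed
  ultimately have int: "((\<lambda>t. k t *\<^sub>R F (cis t)) has_integral F w) {0..2*pi}" by simp
  have contk: "continuous_on UNIV k" unfolding k_def using ne by (intro continuous_intros) auto
  have contFc: "continuous_on UNIV (\<lambda>t. F (cis t))"
    by (rule continuous_on_compose2[OF cont]) (auto intro!: continuous_intros)
  have cont2: "continuous_on UNIV (\<lambda>t. k t *\<^sub>R F (cis t))"
    by (intro continuous_intros contk contFc)
  then have si: "set_integrable lborel {0..2*pi} (\<lambda>t. k t *\<^sub>R F (cis t))"
    by (intro borel_integrable_atLeastAtMost') (rule continuous_on_subset, auto)
  have "(LINT x : {0..2*pi} | lborel. k x *\<^sub>R F (cis x)) = F w"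
    using set_borel_integral_eq_integral(2)[OF si] int by (simp add: integral_unique)
  with si have hb: "has_bochner_integral lborel (\<lambda>x. indicator {0..2*pi} x *\<^sub>R (k x *\<^sub>R F (cis x))) (F w)"
    by (simp add: has_bochner_integral_iff set_integrable_def set_lebesgue_integral_def)
  \<comment> \<open>The contour integral lives on the closed interval, the density on the half-open
    one; they differ in the null point \<open>2*pi\<close>.\<close>
  have eq: "circular_cauchy_density w x *\<^sub>R F (cis x) = indicator {0..<2*pi} x *\<^sub>R (k x *\<^sub>R F (cis x))" for x
    by (simp add: circular_cauchy_density_def k_def)
  show ?thesis unfolding eq
  proof (rule has_bochner_integralI_AE[OF hb])
    show "(\<lambda>x. indicator {0..<2*pi} x *\<^sub>R (k x *\<^sub>R F (cis x))) \<in> borel_measurable lborel"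
      using borel_measurable_continuous_onI[OF contk] borel_measurable_continuous_onI[OF contFc]
      by measurable
    show "AE x in lborel. indicator {0..2*pi} x *\<^sub>R k x *\<^sub>R F (cis x) = indicator {0..<2*pi} x *\<^sub>R k x *\<^sub>R F (cis x)"
      using AE_lborel_singleton[of "2*pi"] by eventually_elim (auto simp: indicator_def)
  qed
qed

text \<open>Since the inner product of b - z with b is nonnegative for z in the disc, pushing b
  outward along its own ray moves it away from z.\<close>

lemma norm_diff_le_dilate:
  fixes b z :: complex
  assumes "cmod b = 1" "cmod z \<le> 1" "e \<ge> 0"
  shows "cmod (b - z) \<le> cmod (of_real (1 + e) * b - z)"
proof -
  have "b \<bullet> z \<le> 1" using norm_cauchy_schwarz[of b z] assms by simp
  moreover have "b \<bullet> b = 1" using assms by (simp add: dot_square_norm)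
  ultimately have "0 \<le> (b - z) \<bullet> b" by (simp add: inner_diff_left inner_commute[of z])
  then have "(b - z) \<bullet> (b - z) \<le> (b - z + e *\<^sub>R b) \<bullet> (b - z + e *\<^sub>R b)"
    using \<open>b \<bullet> b = 1\<close> assms(3) by (simp add: inner_add_left inner_add_right inner_commute[of b "b - z"])
  then have "norm (b - z) \<le> norm (b - z + e *\<^sub>R b)" by (simp add: norm_le)
  then show ?thesis by (simp add: scaleR_conv_of_real algebra_simps)
qed

text \<open>The singularities are cancelled by factors \<open>(b - z) / ((1 + e) b - z)\<close>, which have modulus at most \<open>1\<close>
  on the disc and tend to \<open>1\<close> as \<open>e\<close> tends to \<open>0\<close>, so that \<open>|F|\<close> itself dominates the regularisations.\<close>

lemma circular_cauchy_mean_value: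
  fixes F :: "complex \<Rightarrow> complex"
  assumes B: "finite B" "B \<subseteq> sphere 0 1"
    and cont: "continuous_on (cball 0 1 - B) F" and hol: "F holomorphic_on ball 0 1"
    and lim: "\<And>b. b \<in> B \<Longrightarrow> ((\<lambda>z. (z - b) * F z) \<longlongrightarrow> 0) (at b within cball 0 1)"
    and w: "cmod w < 1"
    and int: "integrable lborel (\<lambda>x. circular_cauchy_density w x *\<^sub>R F (cis x))"
  shows "(\<integral>x. circular_cauchy_density w x *\<^sub>R F (cis x) \<partial>lborel) = F w"
proof -
  define R where "R e z = (\<Prod>b\<in>B. (b - z) / (of_real (1 + e) * b - z))" for e z
  have nb: "cmod b = 1" if "b \<in> B" for b using B that by auto
  have dn: "e \<le> cmod (of_real (1 + e) * b - z)" if "b \<in> B" "cmod z \<le> 1" "e > 0" for e b z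
  proof -
    have "cmod (of_real (1 + e) * b) = 1 + e" using that nb[of b] by (simp add: norm_mult del: of_real_add)
    then show ?thesis using norm_triangle_ineq2[of "of_real (1 + e) * b" z] that by simp
  qed
  have dnz: "of_real (1 + e) * b - z \<noteq> 0" if "b \<in> B" "cmod z \<le> 1" "e > 0" for e b z
    using dn[OF that] that by auto
  have fac: "cmod ((b - z) / (of_real (1 + e) * b - z)) \<le> 1" if "b \<in> B" "cmod z \<le> 1" "e > 0" for e b z
    using norm_diff_le_dilate[OF nb[OF that(1)] that(2), of e] that dnz[OF that]
    by (simp add: norm_divide divide_le_eq_1 del: of_real_add)
  have prod1: "cmod (\<Prod>b\<in>C. (b - z) / (of_real (1 + e) * b - z)) \<le> 1" if "C \<subseteq> B" "cmod z \<le> 1" "e > 0" for C e z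
    unfolding prod_norm[symmetric] by (rule prod_le_1) (use fac that in auto)
  have R1: "cmod (R e z) \<le> 1" if "cmod z \<le> 1" "e > 0" for e z
    unfolding R_def using prod1 that by blast
  have contR: "continuous_on (cball 0 1) (R e)" if "e > 0" for e
    unfolding R_def using dnz that by (intro continuous_intros) auto
  have holR: "R e holomorphic_on ball 0 1" if "e > 0" for e
    unfolding R_def using dnz that by (intro holomorphic_intros) auto
  have contRF: "continuous_on (cball 0 1) (\<lambda>z. R e z * F z)" if e: "e > 0" for e
    unfolding continuous_on_eq_continuous_within
  proof
    fix z0 :: complex assume z0: "z0 \<in> cball 0 1"
    show "continuous (at z0 within cball 0 1) (\<lambda>z. R e z * F z)"
    proof (cases "z0 \<in> B")
      case False
      have "at z0 within cball 0 1 = at z0 within (cball 0 1 - B)"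
        by (rule at_within_nhd[of _ "- B"]) (use False B(1) finite_imp_closed in auto)
      then have "continuous (at z0 within cball 0 1) F"
        using cont z0 False by (simp add: continuous_on_eq_continuous_within)
      then show ?thesis using contR[OF e] z0
        by (auto intro!: continuous_intros simp: continuous_on_eq_continuous_within)
    next
      case True
      have R0: "R e z0 = 0" unfolding R_def using True B(1) by auto
      \<comment> \<open>The factor belonging to \<open>z0\<close> contributes |z - z0| over a
        denominator of modulus at least \<open>e\<close>; the remaining factors have modulus at most
        1. So the growth hypothesis \<open>lim\<close> forces the product to 0 at
        \<open>z0\<close>.\<close>
      have bd: "cmod (R e z * F z) \<le> cmod ((z - z0) * F z) / e" if "z \<in> cball 0 1" for z
      proof -
        have "R e z = (z0 - z) / (of_real (1 + e) * z0 - z) * (\<Prod>b\<in>B-{z0}. (b - z) / (of_real (1 + e) * b - z))"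
          unfolding R_def by (rule prod.remove[OF B(1) True])
        also have "cmod \<dots> \<le> cmod (z - z0) / e * 1"
          unfolding norm_mult norm_divide norm_minus_commute[of z0]
          using prod1[of "B - {z0}" z e] dn[OF True, of z e] that e
          by (intro mult_mono frac_le) (auto simp: norm_mult norm_divide)
        finally have "cmod (R e z) * cmod (F z) \<le> cmod (z - z0) / e * 1 * cmod (F z)"
          by (rule mult_right_mono) simp
        then show ?thesis by (simp add: norm_mult)
      qed
      have "((\<lambda>z. R e z * F z) \<longlongrightarrow> 0) (at z0 within cball 0 1)"
      proof (rule Lim_null_comparison)
        show "\<forall>\<^sub>F z in at z0 within cball 0 1. cmod (R e z * F z) \<le> cmod ((z - z0) * F z) / e"
          using bd by (auto simp: eventually_at_filter)
        show "((\<lambda>z. cmod ((z - z0) * F z) / e) \<longlongrightarrow> 0) (at z0 within cball 0 1)"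
          using tendsto_divide[OF tendsto_norm[OF lim[OF True]] tendsto_const[of e]] e by simp
      qed
      then show ?thesis using R0 by (simp add: continuous_within)
    qed
  qed
  define e where "e n = inverse (real (Suc n))" for n
  have e0: "e n > 0" for n by (simp add: e_def)
  have elim: "e \<longlonglongrightarrow> 0" unfolding e_def by (rule LIMSEQ_inverse_real_of_nat)
  have hb: "has_bochner_integral lborel (\<lambda>x. circular_cauchy_density w x *\<^sub>R (R (e n) (cis x) * F (cis x))) (R (e n) w * F w)" for n
    by (rule Poisson_circular_cauchy) (use contRF holR hol w e0 in \<open>auto intro!: holomorphic_intros\<close>)
  have Rlim: "(\<lambda>n. R (e n) z) \<longlonglongrightarrow> 1" if "z \<notin> B" for z
  proof -
    have "(\<lambda>n. R (e n) z) \<longlonglongrightarrow> (\<Prod>b\<in>B. (b - z) / (of_real (1 + 0) * b - z))"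
      unfolding R_def using that by (intro tendsto_intros elim) auto
    also have "(\<Prod>b\<in>B. (b - z) / (of_real (1 + 0) * b - z)) = 1"
      using that by (intro prod.neutral) auto
    finally show ?thesis .
  qed
  have "(\<lambda>n. \<integral>x. circular_cauchy_density w x *\<^sub>R (R (e n) (cis x) * F (cis x)) \<partial>lborel)
        \<longlonglongrightarrow> (\<integral>x. circular_cauchy_density w x *\<^sub>R F (cis x) \<partial>lborel)"
  proof (rule integral_dominated_convergence)
    show "integrable lborel (\<lambda>x. norm (circular_cauchy_density w x *\<^sub>R F (cis x)))" using int by (rule integrable_norm)
    show "AE x in lborel. norm (circular_cauchy_density w x *\<^sub>R (R (e n) (cis x) * F (cis x))) \<le> norm (circular_cauchy_density w x *\<^sub>R F (cis x))" for n
      using R1[of "cis _" "e n"] e0 by (auto simp: norm_mult intro!: AE_I2 mult_left_mono mult_left_le_one_le)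
    \<comment> \<open>Only finitely many angles of one period hit \<open>B\<close>, a null set.
      Elsewhere the regularising factors tend to 1, and outside the period the density is 0.\<close>
    have "inj_on cis {0..<2*pi}" by (meson cis_eq_iff_interval inj_onI)
    then have "finite (cis -` B \<inter> {0..<2*pi})" using B(1) by (rule finite_vimage_IntI[rotated])
    then have "AE x in lborel. x \<notin> cis -` B \<inter> {0..<2*pi}"
      by (intro AE_not_in finite_imp_null_set_lborel)
    then show "AE x in lborel. (\<lambda>n. circular_cauchy_density w x *\<^sub>R (R (e n) (cis x) * F (cis x))) \<longlonglongrightarrow> circular_cauchy_density w x *\<^sub>R F (cis x)"
    proof eventually_elim
      fix x assume x: "x \<notin> cis -` B \<inter> {0..<2*pi}"
      show "(\<lambda>n. circular_cauchy_density w x *\<^sub>R (R (e n) (cis x) * F (cis x))) \<longlonglongrightarrow> circular_cauchy_density w x *\<^sub>R F (cis x)"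
      proof (cases "x \<in> {0..<2*pi}")
        case True
        with x have "cis x \<notin> B" by auto
        from tendsto_mult[OF Rlim[OF this] tendsto_const[of "F (cis x)"]]
        show ?thesis by (intro tendsto_scaleR tendsto_const) simp
      qed (simp add: circular_cauchy_density_def)
    qed
    show "(\<lambda>x. circular_cauchy_density w x *\<^sub>R (R (e n) (cis x) * F (cis x))) \<in> borel_measurable lborel" for n
      using hb by (auto dest: has_bochner_integral_integrable)
  qed (use int in auto)
  moreover have "(\<integral>x. circular_cauchy_density w x *\<^sub>R (R (e n) (cis x) * F (cis x)) \<partial>lborel) = R (e n) w * F w" for n
    using hb by (rule has_bochner_integral_integral_eq)
  moreover have "(\<lambda>n. R (e n) w * F w) \<longlonglongrightarrow> 1 * F w"
    by (intro tendsto_intros Rlim) (use w B in auto)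
  ultimately show ?thesis using LIMSEQ_unique by fastforce
qed

section \<open>The Cayley transform between disc and upper half plane, and mean values on the half
  plane\<close>

lemma Im_cayley_inv: "z \<noteq> 1 \<Longrightarrow> Im (cayley_inv \<alpha> z) = Im \<alpha> * (1 - (cmod z)\<^sup>2) / (cmod (1 - z))\<^sup>2"
  unfolding cayley_inv_def cmod_power2
  by (simp add: Im_divide) (simp add: field_simps power2_eq_square)

lemma cayley_inv_mem_upper_half_plane:
  "Im \<alpha> > 0 \<Longrightarrow> cmod z < 1 \<Longrightarrow> cayley_inv \<alpha> z \<in> upper_half_plane"
  using Im_cayley_inv[of z \<alpha>] by (cases "z = 1") (auto simp: upper_half_plane_def abs_square_less_1)

lemma cayley_inv_mem_closed_upper_half_plane:
  "Im \<alpha> > 0 \<Longrightarrow> cmod z \<le> 1 \<Longrightarrow> z \<noteq> 1 \<Longrightarrow> cayley_inv \<alpha> z \<in> closed_upper_half_plane"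
  using Im_cayley_inv[of z \<alpha>] by (auto simp: closed_upper_half_plane_def abs_square_le_1)

lemma diff_cnj_neq_0: "Im \<alpha> \<noteq> 0 \<Longrightarrow> \<alpha> - cnj \<alpha> \<noteq> 0"
  by (simp add: complex_eq_iff)

lemma cayley_cayley_inv:
  assumes "Im \<alpha> \<noteq> 0" "z \<noteq> 1"
  shows "cayley \<alpha> (cayley_inv \<alpha> z) = z"
proof -
  have "cayley_inv \<alpha> z - \<alpha> = (\<alpha> - cnj \<alpha>) * z / (1 - z)" "cayley_inv \<alpha> z - cnj \<alpha> = (\<alpha> - cnj \<alpha>) / (1 - z)"
    using assms unfolding cayley_inv_def by (simp_all add: field_simps)
  then show ?thesis using assms diff_cnj_neq_0[of \<alpha>] by (simp add: cayley_def)
qed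

lemma cayley_inv_cayley:
  assumes "Im \<alpha> \<noteq> 0" "z \<noteq> cnj \<alpha>"
  shows "cayley_inv \<alpha> (cayley \<alpha> z) = z"
proof -
  have "\<alpha> - cnj \<alpha> * cayley \<alpha> z = (\<alpha> - cnj \<alpha>) * z / (z - cnj \<alpha>)" "1 - cayley \<alpha> z = (\<alpha> - cnj \<alpha>) / (z - cnj \<alpha>)"
    using assms unfolding cayley_def by (simp_all add: field_simps)
  then show ?thesis using assms diff_cnj_neq_0[of \<alpha>] by (simp add: cayley_inv_def)
qed

lemma cayley_inv_diff:
  "z \<noteq> 1 \<Longrightarrow> b \<noteq> 1 \<Longrightarrow> cayley_inv \<alpha> z - cayley_inv \<alpha> b = (\<alpha> - cnj \<alpha>) * (z - b) / ((1 - z) * (1 - b))"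
  unfolding cayley_inv_def by (simp add: field_simps)

lemma cayley_inv_cis_real: "\<exists>x::real. cayley_inv \<alpha> (cis t) = of_real x"
proof (cases "cis t = 1")
  case False
  then have "Im (cayley_inv \<alpha> (cis t)) = 0" by (simp add: Im_cayley_inv)
  then show ?thesis by (metis complex_is_Real_iff Reals_cases)
\<comment> \<open>At the pole, division by zero gives the value 0, which is real, so the statement
  holds for every angle.\<close>
qed (auto simp: cayley_inv_def intro: exI[of _ 0])

text \<open>Pulling \<open>g\<close> back to the disc leaves two exceptional boundary points:
  \<open>b\<close>, the image of \<open>a\<close>, and 1, the image of infinity. Near 1 the modulus
  of \<open>cayley_inv\<close> is of order 1/|1 - z|, so the growth condition at infinity becomes
  the simple-pole condition there.\<close>

lemma circular_cauchy_mean_value_half_plane: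
  fixes g :: "complex \<Rightarrow> complex" and a :: real
  assumes \<alpha>: "Im \<alpha> > 0" and w: "cmod w < 1"
    and cont: "continuous_on (closed_upper_half_plane - {of_real a}) g"
    and hol: "g holomorphic_on upper_half_plane"
    and lima: "((\<lambda>z. (z - of_real a) * g z) \<longlongrightarrow> 0) (at (of_real a) within closed_upper_half_plane)"
    and limi: "((\<lambda>z. g z / of_real (cmod z)) \<longlongrightarrow> 0) (inf at_infinity (principal closed_upper_half_plane))"
    and int: "integrable lborel (\<lambda>x. circular_cauchy_density w x *\<^sub>R g (cayley_inv \<alpha> (cis x)))"
  shows "(\<integral>x. circular_cauchy_density w x *\<^sub>R g (cayley_inv \<alpha> (cis x)) \<partial>lborel) = g (cayley_inv \<alpha> w)"
proof -
  define b where "b = cayley \<alpha> (of_real a)"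
  have na: "of_real a \<noteq> cnj \<alpha>" "of_real a \<noteq> \<alpha>" using \<alpha> by (auto simp: complex_eq_iff)
  have ib: "cayley_inv \<alpha> b = of_real a" unfolding b_def using \<alpha> na by (intro cayley_inv_cayley) auto
  have b1: "b \<noteq> 1" unfolding b_def cayley_def using na diff_cnj_neq_0[of \<alpha>] \<alpha> by (simp add: divide_eq_1_iff)
  have nb: "cmod b = 1"
  proof -
    have "cmod (of_real a - \<alpha>) = cmod (of_real a - cnj \<alpha>)" by (simp add: cmod_def)
    then show ?thesis unfolding b_def cayley_def using na by (simp add: norm_divide)
  qed
  have inj: "z = b" if "z \<noteq> 1" "cayley_inv \<alpha> z = of_real a" for z
    using cayley_cayley_inv[of \<alpha> z] that \<alpha> by (simp add: b_def)
  show ?thesis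
  proof (rule circular_cauchy_mean_value[where F = "\<lambda>z. g (cayley_inv \<alpha> z)" and B = "{1, b}"])
    show "continuous_on (cball 0 1 - {1, b}) (\<lambda>z. g (cayley_inv \<alpha> z))"
    proof (rule continuous_on_compose2[OF cont])
      show "continuous_on (cball 0 1 - {1, b}) (cayley_inv \<alpha>)"
        unfolding cayley_inv_def by (intro continuous_intros) auto
      show "cayley_inv \<alpha> ` (cball 0 1 - {1, b}) \<subseteq> closed_upper_half_plane - {of_real a}"
        using cayley_inv_mem_closed_upper_half_plane[OF \<alpha>] inj by auto
    qed
    have "g \<circ> cayley_inv \<alpha> holomorphic_on ball 0 1"
    proof (rule holomorphic_on_compose_gen[OF _ hol])
      show "cayley_inv \<alpha> holomorphic_on ball 0 1"
        unfolding cayley_inv_def by (intro holomorphic_intros) auto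
      show "cayley_inv \<alpha> ` ball 0 1 \<subseteq> upper_half_plane"
        using cayley_inv_mem_upper_half_plane[OF \<alpha>] by auto
    qed
    then show "(\<lambda>z. g (cayley_inv \<alpha> z)) holomorphic_on ball 0 1" by (simp add: o_def)
    fix c assume "c \<in> {1, b}"
    then consider "c = b" | "c = 1" by auto
    then show "((\<lambda>z. (z - c) * g (cayley_inv \<alpha> z)) \<longlongrightarrow> 0) (at c within cball 0 1)"
    proof cases
      case 1
      have ev: "\<forall>\<^sub>F z in at b within cball 0 1. z \<in> cball 0 1 \<and> z \<noteq> b \<and> z \<noteq> 1"
        using eventually_at_topological[of "\<lambda>z. z \<in> cball 0 1 \<and> z \<noteq> b \<and> z \<noteq> 1" b "cball 0 1"] b1
        by (metis open_Compl closed_singleton Compl_iff singletonD singletonI)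
      have "((\<lambda>z. cayley_inv \<alpha> z) \<longlongrightarrow> cayley_inv \<alpha> b) (at b within cball 0 1)"
        unfolding cayley_inv_def using b1 by (intro tendsto_intros) auto
      then have "filterlim (cayley_inv \<alpha>) (at (of_real a) within closed_upper_half_plane) (at b within cball 0 1)"
        unfolding filterlim_at ib using ev
        by (auto elim!: eventually_mono dest: inj simp: cayley_inv_mem_closed_upper_half_plane[OF \<alpha>])
      \<comment> \<open>The extra factor is the inverse of the one in
        \<open>cayley_inv_diff\<close>; it has a finite limit at \<open>b\<close> and turns the
        distance to \<open>a\<close> into the distance to \<open>b\<close>.\<close>
      from filterlim_compose[OF lima this]
      have "((\<lambda>z. (cayley_inv \<alpha> z - of_real a) * g (cayley_inv \<alpha> z) * ((1 - z) * (1 - b) / (\<alpha> - cnj \<alpha>)))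
         \<longlongrightarrow> 0 * ((1 - b) * (1 - b) / (\<alpha> - cnj \<alpha>))) (at b within cball 0 1)"
        using \<alpha> by (intro tendsto_intros) (auto simp: complex_eq_iff)
      moreover have "\<forall>\<^sub>F z in at b within cball 0 1.
          (cayley_inv \<alpha> z - of_real a) * g (cayley_inv \<alpha> z) * ((1 - z) * (1 - b) / (\<alpha> - cnj \<alpha>)) = (z - b) * g (cayley_inv \<alpha> z)"
        using ev
      proof eventually_elim
        case (elim z)
        have "\<alpha> - cnj \<alpha> \<noteq> 0" using \<alpha> by (auto simp: complex_eq_iff)
        then have "(cayley_inv \<alpha> z - of_real a) * ((1 - z) * (1 - b) / (\<alpha> - cnj \<alpha>)) = z - b"
          using cayley_inv_diff[of z b \<alpha>] elim b1 unfolding ib by simp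
        then have "((cayley_inv \<alpha> z - of_real a) * ((1 - z) * (1 - b) / (\<alpha> - cnj \<alpha>))) * g (cayley_inv \<alpha> z) = (z - b) * g (cayley_inv \<alpha> z)"
          by (rule arg_cong)
        then show ?case by (simp only: mult_ac)
      qed
      ultimately show ?thesis using 1 by (simp add: tendsto_cong)
    next
      case 2
      have ev: "\<forall>\<^sub>F z in at 1 within cball 0 1. z \<in> cball 0 1 \<and> z \<noteq> (1::complex)"
        by (auto simp: eventually_at_filter)
      have inf: "filterlim (cayley_inv \<alpha>) at_infinity (at 1 within cball 0 1)"
        unfolding cayley_inv_def
      proof (rule filterlim_divide_at_infinity)
        show "((\<lambda>z. \<alpha> - cnj \<alpha> * z) \<longlongrightarrow> \<alpha> - cnj \<alpha> * 1) (at 1 within cball 0 1)" by (intro tendsto_intros)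
        show "filterlim (\<lambda>z. 1 - z) (at 0) (at 1 within cball 0 (1::real) :: complex filter)"
        proof -
          have "((\<lambda>z. 1 - z) \<longlongrightarrow> 1 - 1) (at 1 within cball 0 (1::real) :: complex filter)" by (intro tendsto_intros)
          then show ?thesis unfolding filterlim_at using ev by (auto elim!: eventually_mono)
        qed
        show "\<alpha> - cnj \<alpha> * 1 \<noteq> 0" using \<alpha> by (auto simp: complex_eq_iff)
      qed
      then have "filterlim (cayley_inv \<alpha>) (inf at_infinity (principal closed_upper_half_plane)) (at 1 within cball 0 1)"
        unfolding filterlim_inf filterlim_principal using ev
        by (auto elim!: eventually_mono simp: cayley_inv_mem_closed_upper_half_plane[OF \<alpha>])
      from filterlim_compose[OF limi this]
      have "((\<lambda>z. 2 * cmod (\<alpha> - cnj \<alpha>) * cmod (g (cayley_inv \<alpha> z) / of_real (cmod (cayley_inv \<alpha> z)))) \<longlongrightarrow> 2 * cmod (\<alpha> - cnj \<alpha>) * cmod 0) (at 1 within cball 0 1)"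
        by (intro tendsto_intros)
      \<comment> \<open>Once |y| is at least 2 |\<alpha>|, the shift by \<open>cnj \<alpha>\<close>
        costs at most half of |y|; the added 1 keeps y away from 0.\<close>
      moreover have "2 * cmod \<alpha> + 1 > 0" using norm_ge_zero[of \<alpha>] by linarith
      with inf have big: "\<forall>\<^sub>F z in at 1 within cball 0 1. 2 * cmod \<alpha> + 1 \<le> cmod (cayley_inv \<alpha> z)"
        unfolding filterlim_at_infinity[OF order_refl] by blast
      have "\<forall>\<^sub>F z in at 1 within cball 0 1. cmod ((z - 1) * g (cayley_inv \<alpha> z))
          \<le> 2 * cmod (\<alpha> - cnj \<alpha>) * cmod (g (cayley_inv \<alpha> z) / of_real (cmod (cayley_inv \<alpha> z)))"
        using ev big
      proof eventually_elim
        case (elim z)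
        define y where "y = cayley_inv \<alpha> z"
        have y: "y - cnj \<alpha> = (\<alpha> - cnj \<alpha>) / (1 - z)"
          using elim unfolding y_def cayley_inv_def by (simp add: field_simps)
        have yb: "2 * cmod \<alpha> + 1 \<le> cmod y" using elim \<alpha> by (simp add: y_def)
        have yy: "cmod y \<le> 2 * cmod (y - cnj \<alpha>)"
          using norm_triangle_ineq2[of y "cnj \<alpha>"] yb by simp
        have pos: "cmod y > 0" using yb norm_ge_zero[of \<alpha>] by linarith
        have "cmod (z - 1) * cmod (y - cnj \<alpha>) = cmod (\<alpha> - cnj \<alpha>)"
          unfolding y using elim by (simp add: norm_divide norm_minus_commute)
        then have "cmod (z - 1) * cmod y \<le> 2 * cmod (\<alpha> - cnj \<alpha>)"
          using mult_left_mono[OF yy norm_ge_zero[of "z - 1"]] by simp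
        then have "cmod (z - 1) \<le> 2 * cmod (\<alpha> - cnj \<alpha>) / cmod y" using pos by (simp add: field_simps)
        then have "cmod (z - 1) * cmod (g y) \<le> 2 * cmod (\<alpha> - cnj \<alpha>) / cmod y * cmod (g y)"
          by (rule mult_right_mono) simp
        then show ?case unfolding y_def[symmetric] by (simp add: norm_mult norm_divide)
      qed
      ultimately show ?thesis using 2 by (auto intro: Lim_null_comparison)
    qed
  qed (use nb w int in auto)
qed

section \<open>Measurability, transfer of laws, and centred functions of the sample\<close>

lemma circular_cauchy_density_nonneg: "cmod w < 1 \<Longrightarrow> circular_cauchy_density w x \<ge> 0"
  by (auto simp: circular_cauchy_density_def abs_square_le_1 intro!: mult_nonneg_nonneg divide_nonneg_nonneg)

lemma measurable_circular_cauchy_density [measurable]: "circular_cauchy_density w \<in> borel_measurable borel"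
proof -
  have [measurable]: "cis \<in> borel_measurable borel"
    by (intro borel_measurable_continuous_onI continuous_intros)
  show ?thesis unfolding circular_cauchy_density_def by measurable
qed

lemma measurable_cayley_inv_cis [measurable]: "(\<lambda>t. cayley_inv \<alpha> (cis t)) \<in> borel_measurable borel"
proof -
  have [measurable]: "cis \<in> borel_measurable borel"
    by (intro borel_measurable_continuous_onI continuous_intros)
  show ?thesis unfolding cayley_inv_def by measurable
qed

text \<open>The right-hand side does not mention \<open>X\<close>: variables with a common density
  have images with a common law, which is the form of identical distribution that
  \<open>sample_mean_moments\<close> expects.\<close>

lemma distributed_distr_density:
  assumes "distributed M lborel X p" "h \<in> borel_measurable borel"
  shows "distr M borel (\<lambda>x. h (X x)) = distr (density lborel p) borel h"
proof -
  have "distr (distr M lborel X) borel h = distr M borel (h \<circ> X)"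
    by (rule distr_distr) (use assms distributed_measurable[OF assms(1)] in auto)
  then show ?thesis using distributed_distr_eq_density[OF assms(1)] by (simp add: o_def)
qed

lemma distributed_expectation:
  fixes h :: "real \<Rightarrow> 'b :: {banach, second_countable_topology}"
  assumes X: "distributed M lborel X (\<lambda>x. ennreal (p x))" and p: "p \<in> borel_measurable borel" "\<And>x. p x \<ge> 0"
    and h: "h \<in> borel_measurable borel"
  shows "integrable M (\<lambda>x. h (X x)) \<longleftrightarrow> integrable lborel (\<lambda>x. p x *\<^sub>R h x)"
    and "(\<integral>x. h (X x) \<partial>M) = (\<integral>x. p x *\<^sub>R h x \<partial>lborel)"
proof -
  have mX: "X \<in> measurable M lborel" using distributed_measurable[OF X] .
  have d: "distr M lborel X = density lborel (\<lambda>x. ennreal (p x))" using distributed_distr_eq_density[OF X] .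
  show "integrable M (\<lambda>x. h (X x)) \<longleftrightarrow> integrable lborel (\<lambda>x. p x *\<^sub>R h x)"
    using integrable_distr_eq[OF mX, of h] integrable_density[of h lborel p] p h unfolding d by simp
  show "(\<integral>x. h (X x) \<partial>M) = (\<integral>x. p x *\<^sub>R h x \<partial>lborel)"
    using integral_distr[OF mX, of h] integral_density[of h lborel p] p h unfolding d by simp
qed

lemma tendsto_diff_mult_at_within:
  fixes a :: complex
  assumes "continuous_on S g" "a \<in> S"
  shows "((\<lambda>z. (z - a) * g z) \<longlongrightarrow> 0) (at a within S)"
proof -
  have "(g \<longlongrightarrow> g a) (at a within S)" using assms by (simp add: continuous_on)
  then have "((\<lambda>z. (z - a) * g z) \<longlongrightarrow> (a - a) * g a) (at a within S)" by (intro tendsto_intros)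
  then show ?thesis by simp
qed

text \<open>An exceptional point strictly below the real axis is no singularity for the closed half
  plane, so any real number can take its role. This lets one mean value lemma, with one real
  singularity, serve both cases.\<close>

lemma admissible_generator_real_singularity:
  assumes "admissible_generator U f"
  obtains a :: real where "continuous_on (closed_upper_half_plane - {of_real a}) f"
    and "closed_upper_half_plane - {of_real a} \<subseteq> U"
    and "((\<lambda>z. (z - of_real a) * f z) \<longlongrightarrow> 0) (at (of_real a) within closed_upper_half_plane)"
    and "((\<lambda>z. f z / of_real (cmod z)) \<longlongrightarrow> 0) (inf at_infinity (principal closed_upper_half_plane))"
proof -
  obtain a where cont: "continuous_on U f" and a: "Im a \<le> 0" and sub: "closed_upper_half_plane - {a} \<subseteq> U"
    and lima: "((\<lambda>z. (z - a) * f z) \<longlongrightarrow> 0) (at a within U)"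
    and limi: "((\<lambda>z. f z / of_real (cmod z)) \<longlongrightarrow> 0) (inf at_infinity (principal U))"
    using assms unfolding admissible_generator_def by blast
  have limi': "((\<lambda>z. f z / of_real (cmod z)) \<longlongrightarrow> 0) (inf at_infinity (principal closed_upper_half_plane))"
  proof (rule tendsto_mono[OF _ limi])
    \<comment> \<open>\<open>U\<close> contains the closed half plane only up to \<open>a\<close>,
      but far out \<open>a\<close> is not met.\<close>
    have ne: "eventually (\<lambda>z. z \<noteq> a) at_infinity"
      by (auto simp: eventually_at_infinity intro!: exI[of _ "cmod a + 1"])
    show "inf at_infinity (principal closed_upper_half_plane) \<le> inf at_infinity (principal U)"
      unfolding le_filter_def eventually_inf_principal
    proof (intro allI impI)
      fix P assume "\<forall>\<^sub>F z in at_infinity. z \<in> U \<longrightarrow> P z"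
      with ne show "\<forall>\<^sub>F z in at_infinity. z \<in> closed_upper_half_plane \<longrightarrow> P z"
        by eventually_elim (use sub in auto)
    qed
  qed
  show thesis
  proof (cases "Im a = 0")
    case True
    then have ra: "a = of_real (Re a)" by (simp add: complex_eq_iff)
    have "((\<lambda>z. (z - a) * f z) \<longlongrightarrow> 0) (at a within closed_upper_half_plane)"
    proof (rule tendsto_mono[OF _ lima])
      have "at a within closed_upper_half_plane = at a within (closed_upper_half_plane - {a})"
        by (simp add: at_within_def)
      also have "\<dots> \<le> at a within U" using sub by (rule at_le)
      finally show "at a within closed_upper_half_plane \<le> at a within U" .
    qed
    then show ?thesis using that[of "Re a"] sub continuous_on_subset[OF cont sub] limi' ra by metis
  next
    case False
    then have sub': "closed_upper_half_plane \<subseteq> U" using a sub by (auto simp: closed_upper_half_plane_def)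
    have c': "continuous_on closed_upper_half_plane f" using cont sub' by (rule continuous_on_subset)
    show ?thesis
    \<comment> \<open>The choice of 0 is arbitrary: \<open>f\<close> is continuous there, so
      multiplying by a vanishing factor gives the limit 0.\<close>
    proof (rule that[of 0])
      show "((\<lambda>z. (z - of_real 0) * f z) \<longlongrightarrow> 0) (at (of_real 0) within closed_upper_half_plane)"
        by (rule tendsto_diff_mult_at_within[OF c']) (simp add: closed_upper_half_plane_def)
    qed (use c' sub' limi' in \<open>auto intro: continuous_on_subset\<close>)
  qed
qed

text \<open>All points \<open>cayley_inv \<alpha> (cis t)\<close> are real, and on the real line
  \<open>g\<close> is continuous off the single point \<open>a\<close>; a countable exceptional set
  does not harm measurability.\<close>

lemma borel_measurable_cayley_inv_cis:
  fixes g :: "complex \<Rightarrow> complex" and a :: real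
  assumes "continuous_on (closed_upper_half_plane - {of_real a}) g"
  shows "(\<lambda>t. g (cayley_inv \<alpha> (cis t))) \<in> borel_measurable borel"
proof -
  have "(\<lambda>x. g (of_real x)) \<in> borel_measurable borel"
    by (rule borel_measurable_continuous_countable_exceptions[where X = "{a}"])
      (auto intro!: continuous_on_compose2[OF assms] continuous_intros simp: closed_upper_half_plane_def)
  then have "(\<lambda>t. g (of_real (Re (cayley_inv \<alpha> (cis t))))) \<in> borel_measurable borel"
    by measurable
  moreover have "of_real (Re (cayley_inv \<alpha> (cis t))) = cayley_inv \<alpha> (cis t)" for t
    using cayley_inv_cis_real[of \<alpha> t] by auto
  ultimately show ?thesis by simp
qed

lemma cmod_cayley_real: "Im g \<noteq> 0 \<Longrightarrow> cmod (cayley g (of_real x)) = 1"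
proof -
  assume "Im g \<noteq> 0"
  then have "of_real x - cnj g \<noteq> 0" by (auto simp: complex_eq_iff)
  moreover have "cmod (of_real x - g) = cmod (of_real x - cnj g)" by (simp add: cmod_def)
  ultimately show ?thesis by (simp add: cayley_def norm_divide)
qed

lemma cmod_cayley_less_1:
  assumes "Im \<alpha> > 0" "Im z > 0"
  shows "cmod (cayley \<alpha> z) < 1"
proof -
  have "(cmod (z - \<alpha>))\<^sup>2 < (cmod (z - cnj \<alpha>))\<^sup>2"
    using assms mult_pos_pos[OF assms] unfolding cmod_power2 by (simp add: power2_eq_square algebra_simps)
  then have "cmod (z - \<alpha>) < cmod (z - cnj \<alpha>)" by (rule power_less_imp_less_base) simp
  then show ?thesis unfolding cayley_def norm_divide by (subst divide_less_eq_1_pos) (auto intro: le_less_trans[rotated])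
qed

text \<open>The mean value is the value at \<open>g\<close>, and \<open>cayley g\<close> vanishes
  there, so every positive power is centred. These powers have modulus 1 on the real line and at
  most 1 on the half plane, which supplies integrability and the condition at infinity; the
  singularity 0 passed to the mean value lemma is a dummy.\<close>

lemma cayley_power_mean:
  assumes \<alpha>: "Im \<alpha> > 0" and w: "cmod w < 1" and k: "k > 0"
  defines "g \<equiv> cayley_inv \<alpha> w"
  shows "(\<lambda>t. cayley g (cayley_inv \<alpha> (cis t)) ^ k) \<in> borel_measurable borel"
    and "cmod (cayley g (cayley_inv \<alpha> (cis t))) = 1"
    and "(\<integral>t. circular_cauchy_density w t *\<^sub>R (cayley g (cayley_inv \<alpha> (cis t)) ^ k) \<partial>lborel) = 0"
proof -
  have g: "Im g > 0" using cayley_inv_mem_upper_half_plane[OF \<alpha> w] by (simp add: g_def upper_half_plane_def)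
  have nz: "z - cnj g \<noteq> 0" if "0 \<le> Im z" for z using g that by (auto simp: complex_eq_iff)
  have cont: "continuous_on closed_upper_half_plane (\<lambda>z. cayley g z ^ k)"
    unfolding cayley_def using nz by (intro continuous_intros) (auto simp: closed_upper_half_plane_def)
  then have cont': "continuous_on (closed_upper_half_plane - {of_real 0}) (\<lambda>z. cayley g z ^ k)"
    by (rule continuous_on_subset) auto
  show meas: "(\<lambda>t. cayley g (cayley_inv \<alpha> (cis t)) ^ k) \<in> borel_measurable borel"
    by (rule borel_measurable_cayley_inv_cis[OF cont'])
  show n1: "cmod (cayley g (cayley_inv \<alpha> (cis t))) = 1" for t
    using cayley_inv_cis_real[of \<alpha> t] cmod_cayley_real[of g] g by auto
  \<comment> \<open>The Poisson formula for the constant 1 makes the density integrable; it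
    dominates integrands of modulus 1 times the density.\<close>
  have int1: "integrable lborel (\<lambda>x. circular_cauchy_density w x)"
    using Poisson_circular_cauchy[of "\<lambda>_. 1" w] w by (auto simp: has_bochner_integral_iff scaleR_conv_of_real complex_of_real_integrable_eq)
  have "(\<integral>t. circular_cauchy_density w t *\<^sub>R (cayley g (cayley_inv \<alpha> (cis t)) ^ k) \<partial>lborel)
      = cayley g (cayley_inv \<alpha> w) ^ k"
  proof (rule circular_cauchy_mean_value_half_plane[where g = "\<lambda>z. cayley g z ^ k" and a = 0, OF \<alpha> w])
    show "(\<lambda>z. cayley g z ^ k) holomorphic_on upper_half_plane"
      unfolding cayley_def using nz by (intro holomorphic_intros) (auto simp: upper_half_plane_def)
    show "((\<lambda>z. (z - of_real 0) * cayley g z ^ k) \<longlongrightarrow> 0) (at (of_real 0) within closed_upper_half_plane)"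
      by (rule tendsto_diff_mult_at_within[OF cont]) (simp add: closed_upper_half_plane_def)
    show "integrable lborel (\<lambda>t. circular_cauchy_density w t *\<^sub>R cayley g (cayley_inv \<alpha> (cis t)) ^ k)"
      by (rule Bochner_Integration.integrable_bound[OF int1]) (use meas n1 in \<open>auto simp: norm_power\<close>)
    show "((\<lambda>z. cayley g z ^ k / of_real (cmod z)) \<longlongrightarrow> 0) (inf at_infinity (principal closed_upper_half_plane))"
    proof (rule Lim_null_comparison)
      show "\<forall>\<^sub>F z in inf at_infinity (principal closed_upper_half_plane).
          cmod (cayley g z ^ k / of_real (cmod z)) \<le> inverse (cmod z)"
        unfolding eventually_inf_principal
      proof (intro always_eventually allI impI)
        fix z assume z: "z \<in> closed_upper_half_plane"
        have "cmod (cayley g z) \<le> 1"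
        proof (cases "Im z = 0")
          case True
          then have "z = of_real (Re z)" by (simp add: complex_eq_iff)
          then show ?thesis using cmod_cayley_real[of g "Re z"] g by simp
        next
          case False
          then show ?thesis using cmod_cayley_less_1[OF g, of z] z by (simp add: closed_upper_half_plane_def)
        qed
        then have "cmod (cayley g z ^ k) \<le> 1" by (simp add: norm_power power_le_one)
        then show "cmod (cayley g z ^ k / of_real (cmod z)) \<le> inverse (cmod z)"
          unfolding norm_divide norm_of_real by (simp add: divide_inverse mult_left_le_one_le)
      qed
      have "((\<lambda>z::complex. inverse (cmod z)) \<longlongrightarrow> 0) at_infinity"
        by (rule tendsto_inverse_0_at_top[OF filterlim_norm_at_top])
      then show "((\<lambda>z::complex. inverse (cmod z)) \<longlongrightarrow> 0) (inf at_infinity (principal closed_upper_half_plane))"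
        by (rule filterlim_mono) auto
    qed
  qed (rule cont')
  also have "\<dots> = 0" using k by (simp add: cayley_def g_def)
  finally show "(\<integral>t. circular_cauchy_density w t *\<^sub>R (cayley g (cayley_inv \<alpha> (cis t)) ^ k) \<partial>lborel) = 0" .
qed

section \<open>Moments of sample means\<close>

lemma power_le_1_plus_power4:
  fixes x :: real
  assumes "m \<le> 4"
  shows "\<bar>x\<bar> ^ m \<le> 1 + x ^ 4"
proof (cases "\<bar>x\<bar> \<le> 1")
  case True
  then have "\<bar>x\<bar> ^ m \<le> 1" by (intro power_le_one) auto
  then show ?thesis by (smt (verit) zero_le_even_power even_numeral)
next
  case False
  then have "\<bar>x\<bar> ^ m \<le> \<bar>x\<bar> ^ 4" using assms by (intro power_increasing) auto
  then show ?thesis by (simp add: power_even_abs)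
qed

context prob_space
begin

lemma integrable_power_le_4:
  fixes X :: "'a \<Rightarrow> real"
  assumes [measurable]: "X \<in> borel_measurable M" and "integrable M (\<lambda>x. X x ^ 4)" "m \<le> 4"
  shows "integrable M (\<lambda>x. X x ^ m)"
proof (rule Bochner_Integration.integrable_bound)
  show "integrable M (\<lambda>x. 1 + X x ^ 4)" using assms by simp
  show "AE x in M. norm (X x ^ m) \<le> norm (1 + X x ^ 4)"
    using power_le_1_plus_power4[OF assms(3)] by (auto simp: power_abs)
qed simp

text \<open>In the expansions of (X + S)^2 and (X + S)^4, with S the partial sum independent of the
  new X, all terms containing X or S to the first power have mean 0. The four claims go through the
  induction together, since the fourth moment step uses the mean and second moment of S.\<close>

lemma moments_sum_indep:
  fixes X :: "'i \<Rightarrow> 'a \<Rightarrow> real"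
  assumes fin: "finite J" and ind: "indep_vars (\<lambda>_. borel) X J"
    and int: "\<And>i. i \<in> J \<Longrightarrow> integrable M (\<lambda>x. X i x ^ 4)"
    and mean: "\<And>i. i \<in> J \<Longrightarrow> expectation (X i) = 0"
    and k2: "\<And>i. i \<in> J \<Longrightarrow> expectation (\<lambda>x. X i x ^ 2) \<le> k"
    and k4: "\<And>i. i \<in> J \<Longrightarrow> expectation (\<lambda>x. X i x ^ 4) \<le> k\<^sup>2"
    and k0: "k \<ge> 0"
  shows "integrable M (\<lambda>x. (\<Sum>i\<in>J. X i x) ^ 4)
    \<and> expectation (\<lambda>x. \<Sum>i\<in>J. X i x) = 0
    \<and> expectation (\<lambda>x. (\<Sum>i\<in>J. X i x) ^ 2) = (\<Sum>i\<in>J. expectation (\<lambda>x. X i x ^ 2))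
    \<and> expectation (\<lambda>x. (\<Sum>i\<in>J. X i x) ^ 4) \<le> 3 * (real (card J))\<^sup>2 * k\<^sup>2"
  using fin ind int mean k2 k4
proof (induction J rule: finite_induct)
  case (insert i J)
  define S where "S x = (\<Sum>j\<in>J. X j x)" for x
  have ind: "indep_vars (\<lambda>_. borel) X J"
    using insert.prems(1) by (rule indep_vars_subset) auto
  have IH: "integrable M (\<lambda>x. S x ^ 4)" "expectation S = 0"
     "expectation (\<lambda>x. S x ^ 2) = (\<Sum>i\<in>J. expectation (\<lambda>x. X i x ^ 2))"
     "expectation (\<lambda>x. S x ^ 4) \<le> 3 * (real (card J))\<^sup>2 * k\<^sup>2"
    using insert.IH[OF ind] insert.prems unfolding S_def by auto
  have rv: "X j \<in> borel_measurable M" if "j \<in> insert i J" for j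
    using insert.prems(1) that by (auto simp: indep_vars_def)
  have mX[measurable]: "X i \<in> borel_measurable M" using rv by simp
  have mS[measurable]: "S \<in> borel_measurable M" unfolding S_def using rv by simp
  have iX: "integrable M (\<lambda>x. X i x ^ m)" if "m \<le> 4" for m
    using integrable_power_le_4[OF mX _ that] insert.prems(2) by simp
  have iS: "integrable M (\<lambda>x. S x ^ m)" if "m \<le> 4" for m
    using integrable_power_le_4[OF mS _ that] IH(1) by simp
  have "indep_var borel (X i) borel S"
    unfolding S_def by (rule indep_vars_sum[OF insert.hyps insert.prems(1)])
  then have indp: "indep_var borel (\<lambda>x. X i x ^ p) borel (\<lambda>x. S x ^ q)" for p q
    using indep_var_compose[of borel "X i" borel S "\<lambda>x. x ^ p" borel "\<lambda>x. x ^ q" borel] by (simp add: o_def)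
  have prod: "integrable M (\<lambda>x. X i x ^ p * S x ^ q)"
      "expectation (\<lambda>x. X i x ^ p * S x ^ q) = expectation (\<lambda>x. X i x ^ p) * expectation (\<lambda>x. S x ^ q)"
    if "p \<le> 4" "q \<le> 4" for p q
    using indep_var_integrable[OF indp iX[OF that(1)] iS[OF that(2)]]
      indep_var_lebesgue_integral[OF indp iX[OF that(1)] iS[OF that(2)]] by auto
  have mX0: "expectation (\<lambda>x. X i x ^ 1) = 0" using insert.prems(3) by simp
  have mS0: "expectation (\<lambda>x. S x ^ 1) = 0" using IH(2) by simp
  have sum: "(\<Sum>j\<in>insert i J. X j x) = X i x + S x" for x
    using insert.hyps by (simp add: S_def)
  \<comment> \<open>The exponents 1 are written out so that each mixed term is an instance of
    \<open>prod\<close>.\<close>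
  have e2: "(X i x + S x) ^ 2 = X i x ^ 2 + 2 * (X i x ^ 1 * S x ^ 1) + S x ^ 2" for x
    by (simp add: power2_eq_square algebra_simps)
  have e4: "(X i x + S x) ^ 4 = X i x ^ 4 + 4 * (X i x ^ 3 * S x ^ 1) + 6 * (X i x ^ 2 * S x ^ 2)
      + 4 * (X i x ^ 1 * S x ^ 3) + S x ^ 4" for x
    by (simp add: power2_eq_square power3_eq_cube power4_eq_xxxx algebra_simps)
  have int4: "integrable M (\<lambda>x. (X i x + S x) ^ 4)"
    unfolding e4 using iX[of 4] iS[of 4] prod(1)[of 3 1] prod(1)[of 2 2] prod(1)[of 1 3] by simp
  have "expectation (\<lambda>x. (X i x + S x) ^ 2) = expectation (\<lambda>x. X i x ^ 2) + expectation (\<lambda>x. S x ^ 2)"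
    unfolding e2 using iX[of 2] iS[of 2] prod[of 1 1] mX0 by simp
  moreover have "expectation (\<lambda>x. X i x + S x) = 0"
    using iX[of 1] iS[of 1] mX0 mS0 by simp
  moreover have "expectation (\<lambda>x. (X i x + S x) ^ 4) = expectation (\<lambda>x. X i x ^ 4)
      + 6 * (expectation (\<lambda>x. X i x ^ 2) * expectation (\<lambda>x. S x ^ 2)) + expectation (\<lambda>x. S x ^ 4)"
    unfolding e4 using iX[of 4] iS[of 4] prod[of 3 1] prod[of 2 2] prod[of 1 3] mX0 mS0 by simp
  moreover have "\<dots> \<le> k\<^sup>2 + 6 * (k * (real (card J) * k)) + 3 * (real (card J))\<^sup>2 * k\<^sup>2"
  proof -
    have "expectation (\<lambda>x. S x ^ 2) \<le> real (card J) * k"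
      unfolding IH(3) using sum_bounded_above[of J "\<lambda>i. expectation (\<lambda>x. X i x ^ 2)" k] insert.prems(4) by simp
    then have "expectation (\<lambda>x. X i x ^ 2) * expectation (\<lambda>x. S x ^ 2) \<le> k * (real (card J) * k)"
      using insert.prems(4)[of i] k0 by (intro mult_mono) auto
    then show ?thesis using insert.prems(5)[of i] IH(4) by simp
  qed
  \<comment> \<open>With N = \<open>card J\<close> this reads 1 + 6 N + 3 N^2 \<le> 3 (N + 1)^2; the
    constant 3 is the one whose increment absorbs the cross term 6 N.\<close>
  moreover have "\<dots> \<le> 3 * (real (card (insert i J)))\<^sup>2 * k\<^sup>2"
    using insert.hyps by (simp add: power2_eq_square algebra_simps)
  ultimately show ?case unfolding sum using int4 IH(3) insert.hyps by auto
qed auto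

text \<open>Real and imaginary parts are treated separately; their mutual dependence is harmless
  because |S|^2 = A^2 + B^2 and |S|^4 \<le> 2 A^4 + 2 B^4. The latter turns the real constant 3 into
  2 * 3 + 2 * 3 = 12.\<close>

lemma moments_sum_indep_complex:
  fixes X :: "'i \<Rightarrow> 'a \<Rightarrow> complex"
  assumes fin: "finite J" and ind: "indep_vars (\<lambda>_. borel) X J"
    and int: "\<And>i. i \<in> J \<Longrightarrow> integrable M (\<lambda>x. cmod (X i x) ^ 4)"
    and mean: "\<And>i. i \<in> J \<Longrightarrow> expectation (X i) = 0"
    and k2: "\<And>i. i \<in> J \<Longrightarrow> expectation (\<lambda>x. (cmod (X i x))\<^sup>2) \<le> k"
    and k4: "\<And>i. i \<in> J \<Longrightarrow> expectation (\<lambda>x. cmod (X i x) ^ 4) \<le> k\<^sup>2"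
    and k0: "k \<ge> 0"
  shows "integrable M (\<lambda>x. cmod (\<Sum>i\<in>J. X i x) ^ 4)"
    and "expectation (\<lambda>x. (cmod (\<Sum>i\<in>J. X i x))\<^sup>2) = (\<Sum>i\<in>J. expectation (\<lambda>x. (cmod (X i x))\<^sup>2))"
    and "expectation (\<lambda>x. cmod (\<Sum>i\<in>J. X i x) ^ 4) \<le> 12 * (real (card J))\<^sup>2 * k\<^sup>2"
proof -
  have mX[measurable]: "X j \<in> borel_measurable M" if "j \<in> J" for j
    using ind that by (auto simp: indep_vars_def)
  have iN: "integrable M (\<lambda>x. cmod (X i x) ^ m)" if "i \<in> J" "m \<le> 4" for i m
    using integrable_power_le_4[OF _ int that(2), of i] that mX[of i] by simp
  have iX: "integrable M (X i)" if "i \<in> J" for i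
    using iN[OF that, of 1] mX[OF that] by (simp add: integrable_norm_iff)
  have part: "integrable M (\<lambda>x. (\<Sum>i\<in>J. h (X i x)) ^ 4)
    \<and> expectation (\<lambda>x. \<Sum>i\<in>J. h (X i x)) = 0
    \<and> expectation (\<lambda>x. (\<Sum>i\<in>J. h (X i x)) ^ 2) = (\<Sum>i\<in>J. expectation (\<lambda>x. h (X i x) ^ 2))
    \<and> expectation (\<lambda>x. (\<Sum>i\<in>J. h (X i x)) ^ 4) \<le> 3 * (real (card J))\<^sup>2 * k\<^sup>2"
    "\<And>i. i \<in> J \<Longrightarrow> integrable M (\<lambda>x. h (X i x) ^ 2)"
    if h: "h = Re \<or> h = Im" for h
  proof -
    have mh[measurable]: "h \<in> borel_measurable borel" using h by auto
    have hle: "\<bar>h z\<bar> \<le> cmod z" for z using h abs_Re_le_cmod abs_Im_le_cmod by auto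
    have hp: "\<bar>h z ^ m\<bar> \<le> cmod z ^ m" for z m
      by (simp add: power_abs power_mono hle)
    have ih: "integrable M (\<lambda>x. h (X i x) ^ m)" if "i \<in> J" "m \<le> 4" for i m
      by (rule Bochner_Integration.integrable_bound[OF iN[OF that]])
        (use hp mX[OF that(1)] in \<open>auto intro!: AE_I2 simp: measurable_compose[OF _ mh]\<close>)
    have eh: "expectation (\<lambda>x. h (X i x) ^ m) \<le> expectation (\<lambda>x. cmod (X i x) ^ m)" if "i \<in> J" "m \<le> 4" for i m
      by (rule integral_mono[OF ih[OF that] iN[OF that]]) (use hp abs_le_D1 in blast)
    show "\<And>i. i \<in> J \<Longrightarrow> integrable M (\<lambda>x. h (X i x) ^ 2)" using ih by simp
    have "expectation (\<lambda>x. h (X i x)) = 0" if "i \<in> J" for i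
      using h integral_Re[OF iX[OF that]] integral_Im[OF iX[OF that]] mean[OF that] by auto
    moreover have "indep_vars (\<lambda>_. borel) (\<lambda>i x. h (X i x)) J"
      by (rule indep_vars_compose2[OF ind]) simp
    moreover have "expectation (\<lambda>x. h (X i x) ^ 2) \<le> k" if "i \<in> J" for i
      using eh[OF that, of 2] k2[OF that] by simp
    moreover have "expectation (\<lambda>x. h (X i x) ^ 4) \<le> k\<^sup>2" if "i \<in> J" for i
      using eh[OF that, of 4] k4[OF that] by simp
    ultimately show "integrable M (\<lambda>x. (\<Sum>i\<in>J. h (X i x)) ^ 4)
    \<and> expectation (\<lambda>x. \<Sum>i\<in>J. h (X i x)) = 0
    \<and> expectation (\<lambda>x. (\<Sum>i\<in>J. h (X i x)) ^ 2) = (\<Sum>i\<in>J. expectation (\<lambda>x. h (X i x) ^ 2))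
    \<and> expectation (\<lambda>x. (\<Sum>i\<in>J. h (X i x)) ^ 4) \<le> 3 * (real (card J))\<^sup>2 * k\<^sup>2"
      using ih[of _ 4] k0 by (intro moments_sum_indep[OF fin]) auto
  qed
  define A where "A x = Re (\<Sum>i\<in>J. X i x)" for x
  define B where "B x = Im (\<Sum>i\<in>J. X i x)" for x
  have A: "integrable M (\<lambda>x. A x ^ 4)" "expectation (\<lambda>x. A x ^ 2) = (\<Sum>i\<in>J. expectation (\<lambda>x. Re (X i x) ^ 2))"
     "expectation (\<lambda>x. A x ^ 4) \<le> 3 * (real (card J))\<^sup>2 * k\<^sup>2"
    using part(1)[of Re] by (auto simp: A_def)
  have B: "integrable M (\<lambda>x. B x ^ 4)" "expectation (\<lambda>x. B x ^ 2) = (\<Sum>i\<in>J. expectation (\<lambda>x. Im (X i x) ^ 2))"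
     "expectation (\<lambda>x. B x ^ 4) \<le> 3 * (real (card J))\<^sup>2 * k\<^sup>2"
    using part(1)[of Im] by (auto simp: B_def)
  have mS[measurable]: "(\<lambda>x. \<Sum>i\<in>J. X i x) \<in> borel_measurable M" using mX by simp
  have [measurable]: "A \<in> borel_measurable M" "B \<in> borel_measurable M" unfolding A_def B_def by measurable
  have sq: "(cmod (\<Sum>i\<in>J. X i x))\<^sup>2 = A x ^ 2 + B x ^ 2" for x by (simp add: cmod_power2 A_def B_def)
  have le4: "cmod (\<Sum>i\<in>J. X i x) ^ 4 \<le> 2 * A x ^ 4 + 2 * B x ^ 4" for x
  proof -
    have "cmod (\<Sum>i\<in>J. X i x) ^ 4 = (A x ^ 2 + B x ^ 2)\<^sup>2" by (simp flip: sq power_mult)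
    also have "\<dots> \<le> 2 * (A x ^ 2)\<^sup>2 + 2 * (B x ^ 2)\<^sup>2"
      using sum_squares_bound[of "A x ^ 2" "B x ^ 2"] by (simp add: power2_sum)
    finally show ?thesis by simp
  qed
  have iAB: "integrable M (\<lambda>x. 2 * A x ^ 4 + 2 * B x ^ 4)" using A B by simp
  show i4: "integrable M (\<lambda>x. cmod (\<Sum>i\<in>J. X i x) ^ 4)"
    by (rule Bochner_Integration.integrable_bound[OF iAB]) (use le4 in \<open>auto intro!: AE_I2 order_trans[OF le4] abs_ge_self\<close>)
  have "expectation (\<lambda>x. cmod (\<Sum>i\<in>J. X i x) ^ 4) \<le> expectation (\<lambda>x. 2 * A x ^ 4 + 2 * B x ^ 4)"
    by (rule integral_mono[OF i4 iAB]) (rule le4)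
  also have "\<dots> \<le> 12 * (real (card J))\<^sup>2 * k\<^sup>2" using A B by simp
  finally show "expectation (\<lambda>x. cmod (\<Sum>i\<in>J. X i x) ^ 4) \<le> 12 * (real (card J))\<^sup>2 * k\<^sup>2" .
  have "expectation (\<lambda>x. (cmod (\<Sum>i\<in>J. X i x))\<^sup>2) = expectation (\<lambda>x. A x ^ 2) + expectation (\<lambda>x. B x ^ 2)"
    unfolding sq using integrable_power_le_4[of A 2] integrable_power_le_4[of B 2] A B by simp
  also have "\<dots> = (\<Sum>i\<in>J. expectation (\<lambda>x. (cmod (X i x))\<^sup>2))"
    unfolding A(2) B(2) sum.distrib[symmetric] cmod_power2
    by (intro sum.cong refl) (simp add: part(2))
  finally show "expectation (\<lambda>x. (cmod (\<Sum>i\<in>J. X i x))\<^sup>2) = (\<Sum>i\<in>J. expectation (\<lambda>x. (cmod (X i x))\<^sup>2))" .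
qed


lemma sample_mean_moments:
  fixes X :: "nat \<Rightarrow> 'a \<Rightarrow> complex"
  assumes ind: "indep_vars (\<lambda>_. borel) X {1..}"
    and same: "\<forall>i\<ge>1. distr M borel (X i) = distr M borel (X 1)"
    and int: "integrable M (\<lambda>x. cmod (X 1 x) ^ 4)"
    and mean: "expectation (X 1) = 0"
    and n: "n \<ge> 1"
  shows "integrable M (\<lambda>x. cmod ((\<Sum>i=1..n. X i x) / of_nat n) ^ 4)"
    and "expectation (\<lambda>x. (cmod ((\<Sum>i=1..n. X i x) / of_nat n))\<^sup>2) = expectation (\<lambda>x. (cmod (X 1 x))\<^sup>2) / n"
    and "expectation (\<lambda>x. cmod ((\<Sum>i=1..n. X i x) / of_nat n) ^ 4)
          \<le> 12 * (1 + expectation (\<lambda>x. cmod (X 1 x) ^ 4))\<^sup>2 / (real n)\<^sup>2"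
proof -
  \<comment> \<open>One number must bound the second moment by k and the fourth by k^2. Adding 1
    achieves both: t^2 \<le> 1 + t^4 gives the former, and k \<le> k^2 for k \<ge> 1 the
    latter.\<close>
  define k where "k = 1 + expectation (\<lambda>x. cmod (X 1 x) ^ 4)"
  have k1: "k \<ge> 1" by (simp add: k_def)
  have mX: "X i \<in> borel_measurable M" if "i \<ge> 1" for i
    using ind that by (auto simp: indep_vars_def)
  have eq: "expectation (\<lambda>x. h (X i x)) = expectation (\<lambda>x. h (X 1 x))"
    if "i \<ge> 1" "h \<in> borel_measurable borel" for i and h :: "complex \<Rightarrow> 'c :: {banach, second_countable_topology}"
    using integral_distr[OF mX[OF that(1)] that(2)] integral_distr[OF mX[of 1] that(2)] same[rule_format, OF that(1)] by simp
  have int': "integrable M (\<lambda>x. cmod (X i x) ^ 4)" if "i \<ge> 1" for i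
    using integrable_distr_eq[OF mX[OF that], of "\<lambda>z. cmod z ^ 4"]
      integrable_distr_eq[OF mX[of 1], of "\<lambda>z. cmod z ^ 4"] same[rule_format, OF that] int by simp
  have ind': "indep_vars (\<lambda>_. borel) X {1..n}" using ind by (rule indep_vars_subset) auto
  have e4: "expectation (\<lambda>x. cmod (X i x) ^ 4) \<le> k" if "i \<ge> 1" for i
    using eq[OF that, of "\<lambda>z. cmod z ^ 4"] by (simp add: k_def)
  have e2: "expectation (\<lambda>x. (cmod (X i x))\<^sup>2) \<le> k" if "i \<ge> 1" for i
  proof -
    have "expectation (\<lambda>x. (cmod (X 1 x))\<^sup>2) \<le> expectation (\<lambda>x. 1 + cmod (X 1 x) ^ 4)"
      using integrable_power_le_4[of "\<lambda>x. cmod (X 1 x)" 2] mX[of 1] int power_le_1_plus_power4[of 2 "cmod (X 1 _)"]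
      by (intro integral_mono) auto
    also have "\<dots> = k" using int by (simp add: k_def prob_space)
    finally show ?thesis using eq[OF that, of "\<lambda>z. (cmod z)\<^sup>2"] by simp
  qed
  have "k \<le> k\<^sup>2" using k1 by (simp add: self_le_power)
  then have e4': "expectation (\<lambda>x. cmod (X i x) ^ 4) \<le> k\<^sup>2" if "i \<ge> 1" for i
    using e4[OF that] by simp
  have mean': "expectation (X i) = 0" if "i \<ge> 1" for i
    using eq[OF that, of "\<lambda>z. z"] mean by simp
  note mom = moments_sum_indep_complex[OF finite_atLeastAtMost ind', of k]
  have mom1: "integrable M (\<lambda>x. cmod (\<Sum>i=1..n. X i x) ^ 4)"
    using int' mean' e2 e4' k1 by (intro mom(1)) auto
  have mom2: "expectation (\<lambda>x. (cmod (\<Sum>i=1..n. X i x))\<^sup>2) = (\<Sum>i=1..n. expectation (\<lambda>x. (cmod (X i x))\<^sup>2))"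
    using int' mean' e2 e4' k1 by (intro mom(2)) auto
  have mom3: "expectation (\<lambda>x. cmod (\<Sum>i=1..n. X i x) ^ 4) \<le> 12 * (real (card {1..n}))\<^sup>2 * k\<^sup>2"
    using int' mean' e2 e4' k1 by (intro mom(3)) auto
  have nd: "cmod ((\<Sum>i=1..n. X i x) / of_nat n) ^ p = cmod (\<Sum>i=1..n. X i x) ^ p / real n ^ p" for p x
    by (simp only: norm_divide norm_of_nat power_divide)
  show "integrable M (\<lambda>x. cmod ((\<Sum>i=1..n. X i x) / of_nat n) ^ 4)"
    unfolding nd by (rule Bochner_Integration.integrable_divide) (rule mom1)
  have "(\<Sum>i=1..n. expectation (\<lambda>x. (cmod (X i x))\<^sup>2)) = real n * expectation (\<lambda>x. (cmod (X 1 x))\<^sup>2)"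
    using sum.cong[OF refl eq[of _ "\<lambda>z. (cmod z)\<^sup>2"], of "{1..n}" "\<lambda>i. i"] by simp
  with mom2 show "expectation (\<lambda>x. (cmod ((\<Sum>i=1..n. X i x) / of_nat n))\<^sup>2) = expectation (\<lambda>x. (cmod (X 1 x))\<^sup>2) / n"
    unfolding nd using n by (simp only: integral_divide_zero) (simp add: power2_eq_square)
  have "expectation (\<lambda>x. cmod (\<Sum>i=1..n. X i x) ^ 4) / real n ^ 4 \<le> 12 * (real n)\<^sup>2 * k\<^sup>2 / real n ^ 4"
    using mom3 by (intro divide_right_mono) auto
  also have "\<dots> = 12 * k\<^sup>2 / (real n)\<^sup>2" using n by (simp add: field_simps power2_eq_square power4_eq_xxxx)
  finally show "expectation (\<lambda>x. cmod ((\<Sum>i=1..n. X i x) / of_nat n) ^ 4)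
          \<le> 12 * (1 + expectation (\<lambda>x. cmod (X 1 x) ^ 4))\<^sup>2 / (real n)\<^sup>2"
    unfolding nd k_def by (simp only: integral_divide_zero)
qed

text \<open>Write |V|^2 - |\<kappa> m|^2 as a difference of squares: it is at most C^2 Q^2 + 2 C
  |\<kappa>| |m| Q. The first term has mean of order 1/n^2, and the second is split by a weighted
  arithmetic-geometric inequality, so the main term |\<kappa>|^2 / n survives the scaling. Square
  integrability of V comes from the same bound.\<close>

lemma scaled_second_moment_tendsto:
  fixes V m :: "nat \<Rightarrow> 'a \<Rightarrow> complex" and Q :: "nat \<Rightarrow> 'a \<Rightarrow> real" and \<kappa> :: complex
  assumes mV: "\<And>n. n \<ge> 1 \<Longrightarrow> V n \<in> borel_measurable M"
    and bd: "\<And>n x. n \<ge> 1 \<Longrightarrow> x \<in> space M \<Longrightarrow> cmod (V n x - \<kappa> * m n x) \<le> C * Q n x"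
    and C: "C \<ge> 0" and Q0: "\<And>n x. Q n x \<ge> 0"
    and mi: "\<And>n. n \<ge> 1 \<Longrightarrow> integrable M (\<lambda>x. (cmod (m n x))\<^sup>2)"
    and m: "\<And>n. n \<ge> 1 \<Longrightarrow> expectation (\<lambda>x. (cmod (m n x))\<^sup>2) = 1 / n"
    and Qi: "\<And>n. n \<ge> 1 \<Longrightarrow> integrable M (\<lambda>x. (Q n x)\<^sup>2)"
    and Q: "\<And>n. n \<ge> 1 \<Longrightarrow> expectation (\<lambda>x. (Q n x)\<^sup>2) \<le> K / (real n)\<^sup>2"
  shows "(\<lambda>n. real n * expectation (\<lambda>x. (cmod (V n x))\<^sup>2)) \<longlonglongrightarrow> (cmod \<kappa>)\<^sup>2"
proof -
  define c where "c = cmod \<kappa>"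
  define E where "E n = C\<^sup>2 * K / real n + C * c * (1 + K) / sqrt (real n)" for n
  have bound: "\<bar>real n * expectation (\<lambda>x. (cmod (V n x))\<^sup>2) - c\<^sup>2\<bar> \<le> E n" if n: "n \<ge> 1" for n
  proof -
    \<comment> \<open>This weight balances t E|m|^2 against E Q^2 / t: both are then of order
      n^(-3/2).\<close>
    define t where "t = 1 / sqrt (real n)"
    have t0: "t > 0" using n by (simp add: t_def)
    have tn: "t\<^sup>2 = 1 / n" using n by (simp add: t_def power_divide)
    define H where "H x = C\<^sup>2 * (Q n x)\<^sup>2 + C * c * (t * (cmod (m n x))\<^sup>2 + (Q n x)\<^sup>2 / t)" for x
    have HI: "integrable M H" unfolding H_def using mi[OF n] Qi[OF n] by simp
    have pw: "\<bar>(cmod (V n x))\<^sup>2 - c\<^sup>2 * (cmod (m n x))\<^sup>2\<bar> \<le> H x" if x: "x \<in> space M" for x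
    proof -
      define v where "v = cmod (V n x)"
      define u where "u = c * cmod (m n x)"
      have u0: "u \<ge> 0" "v \<ge> 0" by (auto simp: u_def v_def c_def)
      have CQ: "C * Q n x \<ge> 0" using C Q0 by simp
      have "\<bar>v - u\<bar> \<le> C * Q n x"
        using norm_triangle_ineq3[of "V n x" "\<kappa> * m n x"] bd[OF n x] by (simp add: norm_mult u_def v_def c_def)
      moreover from this have "v + u \<le> C * Q n x + 2 * u" by linarith
      ultimately have "\<bar>v - u\<bar> * (v + u) \<le> C * Q n x * (C * Q n x + 2 * u)"
        using u0 CQ by (intro mult_mono) auto
      moreover have "\<bar>v\<^sup>2 - u\<^sup>2\<bar> = \<bar>v - u\<bar> * (v + u)"
        using u0 by (simp add: power2_eq_square square_diff_square_factored abs_mult mult.commute)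
      moreover have "C * Q n x * (C * Q n x + 2 * u) = C\<^sup>2 * (Q n x)\<^sup>2 + C * c * (2 * cmod (m n x) * Q n x)"
        by (simp add: u_def power2_eq_square algebra_simps)
      moreover have "2 * cmod (m n x) * Q n x \<le> t * (cmod (m n x))\<^sup>2 + (Q n x)\<^sup>2 / t"
      proof -
        have "0 \<le> (t * cmod (m n x) - Q n x)\<^sup>2 / t" using t0 by simp
        also have "\<dots> = t * (cmod (m n x))\<^sup>2 + (Q n x)\<^sup>2 / t - 2 * cmod (m n x) * Q n x"
          using t0 by (simp add: field_simps power2_eq_square)
        finally show ?thesis by simp
      qed
      then have "C * c * (2 * cmod (m n x) * Q n x) \<le> C * c * (t * (cmod (m n x))\<^sup>2 + (Q n x)\<^sup>2 / t)"
        using C by (intro mult_left_mono) (auto simp: c_def)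
      ultimately show ?thesis by (simp add: H_def u_def v_def power_mult_distrib)
    qed
    have VI: "integrable M (\<lambda>x. (cmod (V n x))\<^sup>2)"
    proof (rule Bochner_Integration.integrable_bound)
      show "integrable M (\<lambda>x. H x + c\<^sup>2 * (cmod (m n x))\<^sup>2)" using HI mi[OF n] by simp
      show "AE x in M. norm ((cmod (V n x))\<^sup>2) \<le> norm (H x + c\<^sup>2 * (cmod (m n x))\<^sup>2)"
        using pw by (intro AE_I2) (fastforce simp: abs_le_iff)
    qed (use mV[OF n] in simp)
    have "expectation (\<lambda>x. (cmod (V n x))\<^sup>2) - c\<^sup>2 / n = expectation (\<lambda>x. (cmod (V n x))\<^sup>2 - c\<^sup>2 * (cmod (m n x))\<^sup>2)"
      using VI mi[OF n] m[OF n] by simp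
    also have "\<bar>\<dots>\<bar> \<le> expectation (\<lambda>x. \<bar>(cmod (V n x))\<^sup>2 - c\<^sup>2 * (cmod (m n x))\<^sup>2\<bar>)"
      by (rule integral_abs_bound)
    also have "\<dots> \<le> expectation H"
      using VI mi[OF n] HI pw by (intro integral_mono) auto
    also have "\<dots> = C\<^sup>2 * expectation (\<lambda>x. (Q n x)\<^sup>2) + C * c * (t * (1 / n) + expectation (\<lambda>x. (Q n x)\<^sup>2) / t)"
      unfolding H_def using mi[OF n] Qi[OF n] m[OF n] by simp
    also have "\<dots> \<le> C\<^sup>2 * (K / (real n)\<^sup>2) + C * c * (t * (1 / n) + K / (real n)\<^sup>2 / t)"
      using Q[OF n] C t0 by (intro add_mono mult_left_mono divide_right_mono) (auto simp: c_def)
    finally have "real n * \<bar>expectation (\<lambda>x. (cmod (V n x))\<^sup>2) - c\<^sup>2 / n\<bar>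
        \<le> real n * (C\<^sup>2 * (K / (real n)\<^sup>2) + C * c * (t * (1 / n) + K / (real n)\<^sup>2 / t))"
      by (intro mult_left_mono) auto
    also have "\<dots> = E n"
    proof -
      have "K / (real n)\<^sup>2 / t = t * K / n" using tn t0 n by (simp add: field_simps power2_eq_square)
      then show ?thesis using n by (simp add: E_def t_def field_simps power2_eq_square)
    qed
    finally have "\<bar>real n * (expectation (\<lambda>x. (cmod (V n x))\<^sup>2) - c\<^sup>2 / n)\<bar> \<le> E n"
      by (simp only: abs_mult abs_of_nat)
    then show ?thesis using n by (simp add: right_diff_distrib)
  qed
  have "E \<longlonglongrightarrow> 0" unfolding E_def
  proof (rule tendsto_add_zero)
    show "(\<lambda>n. C\<^sup>2 * K / real n) \<longlonglongrightarrow> 0" by (rule lim_const_over_n)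
    show "(\<lambda>n. C * c * (1 + K) / sqrt (real n)) \<longlonglongrightarrow> 0"
      by (intro tendsto_divide_0[OF tendsto_const] filterlim_at_top_imp_at_infinity
        filterlim_compose[OF sqrt_at_top filterlim_real_sequentially])
  qed
  then have "(\<lambda>n. real n * expectation (\<lambda>x. (cmod (V n x))\<^sup>2) - c\<^sup>2) \<longlonglongrightarrow> 0"
    by (rule Lim_null_comparison[rotated]) (use bound in \<open>auto simp: eventually_sequentially intro!: exI[of _ 1]\<close>)
  then show ?thesis unfolding c_def by (simp add: LIM_zero_iff)
qed

end

section \<open>Fourth moments from exponential moments, and variance as the least second
  moment\<close>

lemma power4_add_le:
  fixes a b :: real
  shows "(a + b) ^ 4 \<le> 8 * (a ^ 4 + b ^ 4)"
proof -
  have "((a + b)\<^sup>2)\<^sup>2 \<le> (2 * a\<^sup>2 + 2 * b\<^sup>2)\<^sup>2"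
    using sum_squares_bound[of a b] by (intro power_mono zero_le_power2) (simp add: power2_sum)
  also have "\<dots> \<le> 8 * ((a\<^sup>2)\<^sup>2 + (b\<^sup>2)\<^sup>2)"
    using sum_squares_bound[of "a\<^sup>2" "b\<^sup>2"] by (simp add: power2_sum power_mult_distrib)
  finally show ?thesis by simp
qed

lemma (in prob_space) integrable_power4_if_exponential_moment:
  fixes Z :: "'a \<Rightarrow> complex"
  assumes [measurable]: "Z \<in> borel_measurable M" and l: "l > 0" and int: "integrable M (\<lambda>x. exp (l * cmod (Z x)))"
  shows "integrable M (\<lambda>x. cmod (Z x - c) ^ 4)"
proof (rule Bochner_Integration.integrable_bound)
  show "integrable M (\<lambda>x. 8 * ((4 / l) ^ 4 * exp (l * cmod (Z x)) + cmod c ^ 4))" using int by simp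
  have "cmod (z - c) ^ 4 \<le> 8 * ((4 / l) ^ 4 * exp (l * cmod z) + cmod c ^ 4)" for z
  proof -
    \<comment> \<open>The comparison is (1 + x/4)^4 \<le> exp x at x = l |z|, which accounts for the
      factor (4/l)^4.\<close>
    have "(l * cmod z / 4) ^ 4 \<le> (1 + l * cmod z / real 4) ^ 4" using l by (intro power_mono) auto
    also have "\<dots> \<le> exp (l * cmod z)"
      by (rule exp_ge_one_plus_x_over_n_power_n) (use l in \<open>auto intro: order_trans[of _ 0]\<close>)
    finally have "(4 / l) ^ 4 * (l * cmod z / 4) ^ 4 \<le> (4 / l) ^ 4 * exp (l * cmod z)"
      by (rule mult_left_mono) (use l in auto)
    then have z4: "cmod z ^ 4 \<le> (4 / l) ^ 4 * exp (l * cmod z)"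
      using l by (simp flip: power_mult_distrib)
    have "cmod (z - c) ^ 4 \<le> (cmod z + cmod c) ^ 4" by (intro power_mono norm_triangle_ineq4) auto
    also have "\<dots> \<le> 8 * (cmod z ^ 4 + cmod c ^ 4)" by (rule power4_add_le)
    also have "\<dots> \<le> 8 * ((4 / l) ^ 4 * exp (l * cmod z) + cmod c ^ 4)"
      by (intro mult_left_mono add_right_mono z4) simp
    finally show ?thesis .
  qed
  then show "AE x in M. norm (cmod (Z x - c) ^ 4) \<le> norm (8 * ((4 / l) ^ 4 * exp (l * cmod (Z x)) + cmod c ^ 4))"
    by (intro AE_I2) (simp add: order_trans[OF _ abs_ge_self])
qed simp

lemma cvariance_le_second_moment:
  fixes V :: "'a \<Rightarrow> complex"
  assumes "prob_space M" and V: "integrable M V" "integrable M (\<lambda>x. (cmod (V x))\<^sup>2)"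
  shows "cvariance M V \<le> (\<integral>x. (cmod (V x - c))\<^sup>2 \<partial>M)"
proof -
  interpret prob_space M by fact
  define \<mu> where "\<mu> = expectation V"
  define r where "r d x = Re (cnj d * V x)" for d x
  have e: "(cmod (V x - d))\<^sup>2 = (cmod (V x))\<^sup>2 - 2 * r d x + (cmod d)\<^sup>2" for x d
    unfolding cmod_power2 by (simp add: r_def power2_eq_square algebra_simps)
  have i: "integrable M (r d)" for d unfolding r_def using V(1) by (intro integrable_Re integrable_mult_right)
  have er: "expectation (r d) = Re (cnj d * \<mu>)" for d
    unfolding r_def using integral_Re[of M "\<lambda>x. cnj d * V x"] V(1) by (simp add: \<mu>_def del: times_complex.sel)
  have "expectation (\<lambda>x. (cmod (V x - d))\<^sup>2) = expectation (\<lambda>x. (cmod (V x))\<^sup>2) - 2 * Re (cnj d * \<mu>) + (cmod d)\<^sup>2" for d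
    unfolding e er[symmetric] using V(2) i[of d] by (simp add: prob_space)
  note ex = this
  \<comment> \<open>Applying the expansion \<open>ex\<close> at c and at the mean, the linear terms
    combine to exactly |\<mu> - c|^2.\<close>
  have "expectation (\<lambda>x. (cmod (V x - c))\<^sup>2) - expectation (\<lambda>x. (cmod (V x - \<mu>))\<^sup>2) = (cmod (\<mu> - c))\<^sup>2"
    unfolding ex unfolding cmod_power2 by (simp add: power2_eq_square algebra_simps)
  then show ?thesis unfolding cvariance_def \<mu>_def[symmetric] using zero_le_power2[of "cmod (\<mu> - c)"] by linarith
qed

section \<open>Expansion of the one-step estimator\<close>

lemma mult_add_le_sum_squares:
  fixes p q d s :: real
  shows "d * (p + q) \<le> d\<^sup>2 + p\<^sup>2 + q\<^sup>2"
proof -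
  have "0 \<le> (d / 2 - p)\<^sup>2 + (d / 2 - q)\<^sup>2 + d\<^sup>2 / 2" by (intro add_nonneg_nonneg) auto
  also have "\<dots> = d\<^sup>2 + p\<^sup>2 + q\<^sup>2 - d * (p + q)" by (simp add: power2_eq_square field_simps)
  finally show ?thesis by simp
qed

text \<open>This is why the step gains an order: apart from a term quadratic in y - g, the error is
  a multiple of (x - g) / (x - cnj y), a perturbation of the centred \<open>cayley g x\<close>. Both
  sides are Moebius functions of x with pole \<open>cnj y\<close>; their values at infinity and
  their residues agree.\<close>

lemma one_step_exact:
  fixes g y :: complex and x :: real
  assumes "Im g > 0" "Im y > 0"
  shows "y + (y - cnj y) * ((of_real x - y) / (of_real x - cnj y)) - g
       = - (y - g)\<^sup>2 / (g - cnj y) + (y - cnj y)\<^sup>2 / (g - cnj y) * ((of_real x - g) / (of_real x - cnj y))"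
proof -
  have "of_real x - cnj y \<noteq> 0" "g - cnj y \<noteq> 0" using assms by (auto simp: complex_eq_iff)
  then show ?thesis by (simp add: divide_simps) (simp add: power2_eq_square algebra_simps)
qed

text \<open>With u = x - g, v = x - cnj g and e = cnj (y - g), the ratio is u / (v - e), and a
  geometric expansion in e is stopped after the linear term. Since v - u = g - cnj g does not depend
  on x, the coefficient u / v^2 is a multiple of S - S^2 with S = u / v, so averaging it requires
  only \<open>m1\<close> and \<open>m2\<close>.\<close>

lemma cayley_expansion:
  fixes g y :: complex and x :: real
  assumes "Im g > 0" "Im y > 0"
  shows "(of_real x - g) / (of_real x - cnj y) = cayley g (of_real x)
      + cnj (y - g) / (g - cnj g) * (cayley g (of_real x) - (cayley g (of_real x))\<^sup>2)
      + (cnj (y - g))\<^sup>2 * (cayley g (of_real x) / ((of_real x - cnj g) * (of_real x - cnj y)))"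
proof -
  define u v e where "u = of_real x - g" "v = of_real x - cnj g" "e = cnj (y - g)"
  have nz: "v \<noteq> 0" "v - e \<noteq> 0" "v - u \<noteq> 0"
    using assms by (auto simp: u_v_e_def complex_eq_iff)
  have "e / (v - u) * (u / v - (u / v)\<^sup>2) = e * u / v\<^sup>2"
    using nz by (simp add: divide_simps) (simp add: power2_eq_square algebra_simps)
  moreover have "u / (v - e) = u / v + e * u / v\<^sup>2 + e\<^sup>2 * (u / v / (v * (v - e)))"
    using nz by (simp add: divide_simps) (simp add: power2_eq_square algebra_simps)
  ultimately have "u / (v - e) = u / v + e / (v - u) * (u / v - (u / v)\<^sup>2) + e\<^sup>2 * (u / v / (v * (v - e)))"
    by simp
  moreover have "v - e = of_real x - cnj y" "v - u = g - cnj g"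
    by (simp_all add: u_v_e_def)
  ultimately show ?thesis by (simp only: cayley_def u_v_e_def)
qed

text \<open>Averaging the two preceding identities leaves \<open>(g - cnj g) * m1\<close> plus terms
  of second order in y - g, \<open>m1\<close> and \<open>m2\<close>. The radius Im g / 2 keeps y at
  height at least Im g / 2, so all denominators x - cnj y are bounded below uniformly in real
  x.\<close>

lemma one_step_expansion:
  fixes g y :: complex and x :: "nat \<Rightarrow> real" and n :: nat
  defines "m1 \<equiv> (\<Sum>j=1..n. cayley g (of_real (x j))) / of_nat n"
    and "m2 \<equiv> (\<Sum>j=1..n. (cayley g (of_real (x j)))\<^sup>2) / of_nat n"
    and "z \<equiv> y + 2 * of_real (Im y) * \<i> / of_nat n * (\<Sum>j=1..n. (of_real (x j) - y) / (of_real (x j) - cnj y))"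
  assumes g: "Im g > 0" and y: "cmod (y - g) \<le> Im g / 2" and n: "n \<ge> 1"
  shows "cmod (z - g - (g - cnj g) * m1)
     \<le> (19 / Im g + 13) * ((cmod (y - g))\<^sup>2 + (cmod m1)\<^sup>2 + (cmod m2)\<^sup>2)"
proof -
  define s where "s = Im g"
  define d where "d = cmod (y - g)"
  define c where "c j = cayley g (of_real (x j))" for j
  define t where "t j = c j / ((of_real (x j) - cnj g) * (of_real (x j) - cnj y))" for j
  define r where "r = (\<Sum>j=1..n. t j) / of_nat n"
  define K where "K = (y - cnj y)\<^sup>2 / (g - cnj y)"
  have s0: "s > 0" using g by (simp add: s_def)
  have d0: "0 \<le> d" "d \<le> s / 2" using y by (auto simp: d_def s_def)
  have n0: "of_nat n \<noteq> (0::complex)" using n by simp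
  have "\<bar>Im (y - g)\<bar> \<le> s / 2" using abs_Im_le_cmod[of "y - g"] d0 by (simp add: d_def)
  then have Iy: "Im y \<ge> s / 2" unfolding s_def minus_complex.sel by arith
  have yc: "y - cnj y = 2 * of_real (Im y) * \<i>" by (simp add: complex_eq_iff)
  have gy: "cmod (g - cnj y) \<ge> s"
    using abs_Im_le_cmod[of "g - cnj y"] Iy s0 by (simp add: s_def)
  have summand: "y + (y - cnj y) * ((of_real (x j) - y) / (of_real (x j) - cnj y)) - g
     = - (y - g)\<^sup>2 / (g - cnj y) + K * (c j + cnj (y - g) / (g - cnj g) * (c j - (c j)\<^sup>2) + (cnj (y - g))\<^sup>2 * t j)" for j
    using one_step_exact[of g y "x j"] cayley_expansion[of g y "x j"] g Iy s0
    by (simp add: K_def c_def t_def)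
  have "of_nat n * (z - g) = (\<Sum>j=1..n. y + (y - cnj y) * ((of_real (x j) - y) / (of_real (x j) - cnj y)) - g)"
  proof -
    define T where "T = (\<Sum>j=1..n. (of_real (x j) - y) / (of_real (x j) - cnj y))"
    have "of_nat n * (z - g) = of_nat n * y + (y - cnj y) * T - of_nat n * g"
      using n0 unfolding z_def yc T_def[symmetric] by (simp add: field_simps)
    also have "\<dots> = (\<Sum>j=1..n. y + (y - cnj y) * ((of_real (x j) - y) / (of_real (x j) - cnj y)) - g)"
      unfolding T_def by (simp only: sum.distrib sum_subtractf sum_distrib_left sum_constant) simp
    finally show ?thesis .
  qed
  also have "\<dots> = of_nat n * (- (y - g)\<^sup>2 / (g - cnj y)) + K * ((\<Sum>j=1..n. c j)
        + cnj (y - g) / (g - cnj g) * ((\<Sum>j=1..n. c j) - (\<Sum>j=1..n. (c j)\<^sup>2)) + (cnj (y - g))\<^sup>2 * (\<Sum>j=1..n. t j))"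
    unfolding summand by (simp only: sum.distrib sum_subtractf sum_distrib_left[symmetric] sum_constant) simp
  also have "\<dots> = of_nat n * (- (y - g)\<^sup>2 / (g - cnj y) + K * (m1 + cnj (y - g) / (g - cnj g) * (m1 - m2) + (cnj (y - g))\<^sup>2 * r))"
  proof -
    have "(\<Sum>j=1..n. c j) = of_nat n * m1" "(\<Sum>j=1..n. (c j)\<^sup>2) = of_nat n * m2" "(\<Sum>j=1..n. t j) = of_nat n * r"
      using n0 by (simp_all add: m1_def m2_def c_def r_def)
    then show ?thesis by (simp only:) (simp add: algebra_simps)
  qed
  finally have "z - g = - (y - g)\<^sup>2 / (g - cnj y) + K * (m1 + cnj (y - g) / (g - cnj g) * (m1 - m2) + (cnj (y - g))\<^sup>2 * r)"
    using n0 by (simp only: mult_cancel_left) simp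
  then have eq: "z - g - (g - cnj g) * m1 = - ((y - g)\<^sup>2 / (g - cnj y)) + (K - (g - cnj g)) * m1
      + K * (cnj (y - g) / (g - cnj g) * (m1 - m2)) + K * ((cnj (y - g))\<^sup>2 * r)"
    by (simp add: algebra_simps)
  have gg: "cmod (g - cnj g) = 2 * s"
    using g by (simp add: complex_diff_cnj norm_mult s_def)
  have n1: "cmod ((y - g)\<^sup>2 / (g - cnj y)) \<le> d\<^sup>2 / s"
    unfolding norm_divide norm_power d_def[symmetric] using gy s0 by (intro frac_le) auto
  have dc: "cmod (cnj (y - g)) = d" by (simp add: d_def del: complex_cnj_diff)
  have "cmod (y - cnj y) \<le> 3 * s"
  proof -
    have "y - cnj y = (g - cnj g) + (y - g) - cnj (y - g)" by simp
    then have "cmod (y - cnj y) \<le> 2 * s + d + d"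
      using norm_triangle_ineq4[of "(g - cnj g) + (y - g)" "cnj (y - g)"] norm_triangle_ineq[of "g - cnj g" "y - g"] gg dc d_def by simp
    then show ?thesis using d0 by simp
  qed
  then have "(cmod (y - cnj y))\<^sup>2 \<le> (3 * s)\<^sup>2" by (rule power_mono) simp
  then have nK: "cmod K \<le> 9 * s"
    unfolding K_def norm_divide norm_power
    using gy s0 frac_le[of "(3 * s)\<^sup>2" "(cmod (y - cnj y))\<^sup>2" s "cmod (g - cnj y)"]
    by (simp add: power2_eq_square)
  \<comment> \<open>At y = g the prefactor \<open>K\<close> is g - cnj g. The numerator of the
    difference is at most 6 s d + 4 d^2, and 4 d^2 \<le> 2 s d by d \<le> s / 2.\<close>
  have nK2: "cmod (K - (g - cnj g)) \<le> 8 * d"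
  proof -
    have "g - cnj y \<noteq> 0" using gy s0 by auto
    then have "K - (g - cnj g) = ((g - cnj g) * (2 * (y - g) - cnj (y - g)) + ((y - g) - cnj (y - g))\<^sup>2) / (g - cnj y)"
      unfolding K_def complex_cnj_diff by (simp add: divide_simps) (simp add: power2_eq_square algebra_simps)
    moreover have "cmod ((g - cnj g) * (2 * (y - g) - cnj (y - g)) + ((y - g) - cnj (y - g))\<^sup>2) \<le> 2 * s * (3 * d) + (2 * d)\<^sup>2"
    proof -
      have "cmod (2 * (y - g) - cnj (y - g)) \<le> 3 * d"
        using norm_triangle_ineq4[of "2 * (y - g)" "cnj (y - g)"] unfolding dc norm_mult by (simp add: d_def)
      moreover have "cmod ((y - g) - cnj (y - g)) \<le> 2 * d"
        using norm_triangle_ineq4[of "y - g" "cnj (y - g)"] unfolding dc by (simp add: d_def)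
      ultimately have "2 * s * cmod (2 * (y - g) - cnj (y - g)) \<le> 2 * s * (3 * d)"
          "(cmod ((y - g) - cnj (y - g)))\<^sup>2 \<le> (2 * d)\<^sup>2"
        using s0 by - (rule mult_left_mono, assumption, simp, rule power_mono, assumption, simp)
      then show ?thesis
        by (intro order_trans[OF norm_triangle_ineq] add_mono) (simp_all only: norm_mult norm_power gg)
    qed
    moreover have "2 * s * (3 * d) + (2 * d)\<^sup>2 \<le> 8 * d * s"
      using d0 mult_left_mono[OF d0(2) d0(1)] by (simp add: power2_eq_square)
    ultimately have "cmod (K - (g - cnj g)) \<le> 8 * d * s / s"
      using gy s0 d0 by (simp only: norm_divide) (rule frac_le, simp, erule order_trans, assumption+)
    then show ?thesis using s0 by simp
  qed
  have tb: "cmod (t j) \<le> 2 / s\<^sup>2" for j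
  proof -
    have "s \<le> cmod (of_real (x j) - cnj g)" using abs_Im_le_cmod[of "of_real (x j) - cnj g"] s0 by (simp add: s_def)
    moreover have "s / 2 \<le> cmod (of_real (x j) - cnj y)" using abs_Im_le_cmod[of "of_real (x j) - cnj y"] s0 Iy by simp
    ultimately have "s * (s / 2) \<le> cmod (of_real (x j) - cnj g) * cmod (of_real (x j) - cnj y)"
      using s0 by (intro mult_mono) auto
    then have "cmod (t j) \<le> 1 / (s * (s / 2))"
      unfolding t_def norm_divide norm_mult c_def using cmod_cayley_real[of g "x j"] g s0 by (intro frac_le) auto
    then show ?thesis by (simp add: power2_eq_square)
  qed
  have nr: "cmod r \<le> 2 / s\<^sup>2"
  proof -
    have "cmod (\<Sum>j=1..n. t j) \<le> real n * (2 / s\<^sup>2)"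
      using sum_norm_bound[of "{1..n}" t "2 / s\<^sup>2"] tb by simp
    then show ?thesis using n by (simp add: r_def norm_divide field_simps)
  qed
  have n3: "cmod (K * (cnj (y - g) / (g - cnj g) * (m1 - m2))) \<le> 9 * s * (d / (2 * s) * (cmod m1 + cmod m2))"
    unfolding norm_mult norm_divide gg dc using nK s0 d0 norm_triangle_ineq4[of m1 m2]
    by (intro mult_mono) auto
  have n4: "cmod (K * ((cnj (y - g))\<^sup>2 * r)) \<le> 9 * s * (d\<^sup>2 * (2 / s\<^sup>2))"
    unfolding norm_mult norm_power dc using nK s0 nr by (intro mult_mono) auto
  have n2: "cmod ((K - (g - cnj g)) * m1) \<le> 8 * d * cmod m1"
    unfolding norm_mult using nK2 by (intro mult_right_mono) auto
  define Q where "Q = d\<^sup>2 + (cmod m1)\<^sup>2 + (cmod m2)\<^sup>2"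
  have Q0: "Q \<ge> 0" "d\<^sup>2 \<le> Q" by (auto simp: Q_def)
  have cub: "d * (cmod m1 + cmod m2) \<le> Q" unfolding Q_def by (rule mult_add_le_sum_squares)
  have cub1: "d * cmod m1 \<le> Q" using cub mult_nonneg_nonneg[OF d0(1) norm_ge_zero[of m2]] by (simp add: distrib_left)
  have "cmod (z - g - (g - cnj g) * m1) \<le> d\<^sup>2 / s + 8 * d * cmod m1 + 9 * s * (d / (2 * s) * (cmod m1 + cmod m2)) + 9 * s * (d\<^sup>2 * (2 / s\<^sup>2))"
    unfolding eq
    by (intro order_trans[OF norm_triangle_ineq] add_mono n2 n3 n4) (use n1 in simp)
  \<comment> \<open>19 = 1 + 18 collects the two terms in d^2; below, 8 + 9/2 is rounded up to
    13.\<close>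
  also have "\<dots> = 19 / s * d\<^sup>2 + 8 * (d * cmod m1) + 9 / 2 * (d * (cmod m1 + cmod m2))"
    using s0 by (simp add: field_simps power2_eq_square)
  also have "\<dots> \<le> 19 / s * Q + 8 * Q + 9 / 2 * Q"
    using Q0 cub cub1 s0 by (intro add_mono mult_left_mono) auto
  also have "\<dots> \<le> (19 / s + 13) * Q" using Q0 by (simp add: algebra_simps)
  finally show ?thesis by (simp add: Q_def d_def s_def)
qed

section \<open>From the half plane back to the disc: linearisation with a uniform constant\<close>

lemma cayley_taylor:
  fixes \<alpha> g z :: complex
  assumes "Im \<alpha> > 0" "Im g > 0" "Im z > 0"
  shows "cmod (cayley \<alpha> z - cayley \<alpha> g - (\<alpha> - cnj \<alpha>) / (g - cnj \<alpha>)\<^sup>2 * (z - g)) \<le> 2 / (Im \<alpha>)\<^sup>2 * (cmod (z - g))\<^sup>2"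
proof -
  define a where "a = Im \<alpha>"
  have a0: "a > 0" using assms by (simp add: a_def)
  have nz: "z - cnj \<alpha> \<noteq> 0" "g - cnj \<alpha> \<noteq> 0" using assms by (auto simp: complex_eq_iff)
  \<comment> \<open>For a Moebius map the Taylor remainder is explicit. Each of its three
    denominator factors has modulus at least Im \<alpha>, and |\<alpha> - cnj \<alpha>| = 2 Im
    \<alpha>, whence 2 / (Im \<alpha>)^2.\<close>
  have "cayley \<alpha> z - cayley \<alpha> g - (\<alpha> - cnj \<alpha>) / (g - cnj \<alpha>)\<^sup>2 * (z - g) = - ((\<alpha> - cnj \<alpha>) * (z - g)\<^sup>2) / ((z - cnj \<alpha>) * (g - cnj \<alpha>)\<^sup>2)"
    unfolding cayley_def using nz by (simp add: divide_simps) (simp add: power2_eq_square algebra_simps)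
  moreover have "a \<le> cmod (z - cnj \<alpha>)" using abs_Im_le_cmod[of "z - cnj \<alpha>"] assms by (simp add: a_def)
  moreover have "a \<le> cmod (g - cnj \<alpha>)" using abs_Im_le_cmod[of "g - cnj \<alpha>"] assms by (simp add: a_def)
  ultimately have "cmod (cayley \<alpha> z - cayley \<alpha> g - (\<alpha> - cnj \<alpha>) / (g - cnj \<alpha>)\<^sup>2 * (z - g)) \<le> 2 * a * (cmod (z - g))\<^sup>2 / (a * a\<^sup>2)"
    using a0 by (simp only: norm_divide norm_mult norm_power norm_minus_cancel)
      (intro frac_le mult_mono power_mono; simp add: complex_diff_cnj norm_mult flip: a_def)
  then show ?thesis using a0 by (simp add: a_def power2_eq_square)
qed

text \<open>The case of equality in the Schwarz-Pick inequality: (\<alpha> - cnj \<alpha>) / (g -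
  cnj \<alpha>)^2 is the derivative of \<open>cayley \<alpha>\<close> at g, and |g - cnj g| = 2 Im
  g. This identifies the asymptotic constant.\<close>

lemma one_minus_cmod_cayley_square:
  assumes "Im \<alpha> > 0" "Im g > 0"
  shows "cmod ((g - cnj g) * ((\<alpha> - cnj \<alpha>) / (g - cnj \<alpha>)\<^sup>2)) = 1 - (cmod (cayley \<alpha> g))\<^sup>2"
proof -
  have nz: "(cmod (g - cnj \<alpha>))\<^sup>2 \<noteq> 0" using assms by (auto simp: complex_eq_iff)
  have "(cmod (g - cnj \<alpha>))\<^sup>2 - (cmod (g - \<alpha>))\<^sup>2 = 4 * Im g * Im \<alpha>"
    unfolding cmod_power2 by (simp add: power2_eq_square algebra_simps)
  moreover have "cmod ((g - cnj g) * ((\<alpha> - cnj \<alpha>) / (g - cnj \<alpha>)\<^sup>2)) = 4 * Im g * Im \<alpha> / (cmod (g - cnj \<alpha>))\<^sup>2"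
    using assms by (simp add: norm_mult norm_divide norm_power complex_diff_cnj)
  ultimately show ?thesis using nz by (simp add: cayley_def norm_divide power_divide diff_divide_distrib[symmetric] field_simps)
qed

text \<open>A small right-hand sum forces y near g and z into the half plane, where both expansions
  apply; a large one makes the bound trivial, since \<open>W\<close> and all averages of
  \<open>cayley g\<close> have modulus at most 1. The control of y is demanded for D \<le> \<delta>
  only, because an inverse of the generator is controlled near one point only.\<close>

lemma one_step_cayley_linearization:
  fixes \<alpha> g :: complex and L \<delta> :: real
  assumes \<alpha>: "Im \<alpha> > 0" and g: "Im g > 0" and L: "L \<ge> 0" and \<delta>: "\<delta> > 0"
  obtains C where "C \<ge> 0"
    and "\<And>n (x :: nat \<Rightarrow> real) y z W D.
      \<lbrakk>n \<ge> 1; D \<ge> 0; D \<le> \<delta> \<Longrightarrow> cmod (y - g) \<le> L * D;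
       z = y + 2 * of_real (Im y) * \<i> / of_nat n * (\<Sum>j=1..n. (of_real (x j) - y) / (of_real (x j) - cnj y));
       Im z > 0 \<Longrightarrow> W = cayley \<alpha> z; Im z \<le> 0 \<Longrightarrow> cmod W \<le> 1\<rbrakk>
      \<Longrightarrow> cmod (W - cayley \<alpha> g - (g - cnj g) * ((\<alpha> - cnj \<alpha>) / (g - cnj \<alpha>)\<^sup>2) *
              ((\<Sum>j=1..n. cayley g (of_real (x j))) / of_nat n))
        \<le> C * (D\<^sup>2 + (cmod ((\<Sum>j=1..n. cayley g (of_real (x j))) / of_nat n))\<^sup>2
              + (cmod ((\<Sum>j=1..n. (cayley g (of_real (x j)))\<^sup>2) / of_nat n))\<^sup>2)"
proof -
  define s where "s = Im g"
  define b where "b = (\<alpha> - cnj \<alpha>) / (g - cnj \<alpha>)\<^sup>2"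
  define \<kappa> where "\<kappa> = (g - cnj g) * b"
  define C1 where "C1 = (19 / s + 13) * (L\<^sup>2 + 1)"
  \<comment> \<open>The entries serve in turn: validity of the bound on y; |y - g| \<le> s / 2; and,
    from 1/8 and the last one, two contributions of s / 4 each to |z - g|, so that Im z > 0. The
    added ones avoid division by zero.\<close>
  define \<eta> where "\<eta> = Min {\<delta>, s / (2 * (L + 1)), 1 / 8, s / (4 * (C1 + 1))}"
  define Cg where "Cg = 2 / (Im \<alpha>)\<^sup>2 * (8 * s\<^sup>2 + 2 * C1\<^sup>2) + cmod b * C1"
  \<comment> \<open>\<open>Cg\<close> handles Q \<le> \<eta>^2, combining the Taylor remainder with
    the image of the one-step error; the other summand makes C Q exceed 2 + |\<kappa>| once Q >
    \<eta>^2.\<close>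
  define C where "C = Cg + (2 + cmod \<kappa>) / \<eta>\<^sup>2"
  have s0: "s > 0" using g by (simp add: s_def)
  have C10: "C1 \<ge> 0" using s0 by (simp add: C1_def)
  have \<eta>le: "\<eta> \<le> u" if "u \<in> {\<delta>, s / (2 * (L + 1)), 1 / 8, s / (4 * (C1 + 1))}" for u
    unfolding \<eta>_def by (rule Min_le[OF _ that]) simp
  have \<eta>: "\<eta> > 0" "\<eta> \<le> \<delta>" "\<eta> \<le> s / (2 * (L + 1))" "\<eta> \<le> 1 / 8" "\<eta> \<le> s / (4 * (C1 + 1))"
    using s0 L \<delta> C10 by (simp add: \<eta>_def) (rule \<eta>le, simp)+
  have L\<eta>: "L * \<eta> \<le> s / 2"
  proof -
    have "L * \<eta> \<le> (L + 1) * \<eta>" using \<eta>(1) by simp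
    also have "\<dots> \<le> s / 2" using \<eta>(3) L by (simp add: field_simps)
    finally show ?thesis .
  qed
  have C1\<eta>: "C1 * \<eta> \<le> s / 4"
  proof -
    have "C1 * \<eta> \<le> (C1 + 1) * \<eta>" using \<eta>(1) by simp
    also have "\<dots> \<le> s / 4" using \<eta>(5) C10 by (simp add: field_simps)
    finally show ?thesis .
  qed
  have \<eta>2: "\<eta>\<^sup>2 \<le> \<eta>" "\<eta>\<^sup>2 > 0" using \<eta>(1,4) mult_left_le[of \<eta> \<eta>] by (auto simp: power2_eq_square)
  have Cg0: "Cg \<ge> 0" unfolding Cg_def using C10 by (intro add_nonneg_nonneg mult_nonneg_nonneg) auto
  show thesis
  proof (rule that)
    show "C \<ge> 0" unfolding C_def using Cg0 by simp
    fix n :: nat and x :: "nat \<Rightarrow> real" and y z W :: complex and D :: real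
    assume n: "n \<ge> 1" and D0: "D \<ge> 0" and D: "D \<le> \<delta> \<Longrightarrow> cmod (y - g) \<le> L * D"
      and z: "z = y + 2 * of_real (Im y) * \<i> / of_nat n * (\<Sum>j=1..n. (of_real (x j) - y) / (of_real (x j) - cnj y))"
      and W: "Im z > 0 \<Longrightarrow> W = cayley \<alpha> z" "Im z \<le> 0 \<Longrightarrow> cmod W \<le> 1"
    define m1 where "m1 = (\<Sum>j=1..n. cayley g (of_real (x j))) / of_nat n"
    define m2 where "m2 = (\<Sum>j=1..n. (cayley g (of_real (x j)))\<^sup>2) / of_nat n"
    define Q where "Q = D\<^sup>2 + (cmod m1)\<^sup>2 + (cmod m2)\<^sup>2"
    have Q0: "Q \<ge> 0" "D\<^sup>2 \<le> Q" "(cmod m1)\<^sup>2 \<le> Q" by (auto simp: Q_def)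
    have "cmod (W - cayley \<alpha> g - \<kappa> * m1) \<le> C * Q"
    proof (cases "Q \<le> \<eta>\<^sup>2")
      case True
      have DQ: "D \<le> \<eta>" "cmod m1 \<le> \<eta>"
        using power2_le_imp_le[OF order_trans[OF Q0(2) True]] power2_le_imp_le[OF order_trans[OF Q0(3) True]] \<eta>(1) by auto
      have yg: "cmod (y - g) \<le> L * D" using D DQ \<eta>(2) by simp
      have "L * D \<le> L * \<eta>" using DQ L by (intro mult_left_mono) auto
      with yg L\<eta> have yg2: "cmod (y - g) \<le> Im g / 2" by (simp add: s_def)
      have "cmod (z - g - (g - cnj g) * m1) \<le> (19 / s + 13) * ((cmod (y - g))\<^sup>2 + (cmod m1)\<^sup>2 + (cmod m2)\<^sup>2)"
        unfolding z m1_def m2_def s_def by (rule one_step_expansion[OF g yg2 n])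
      also have "\<dots> \<le> (19 / s + 13) * ((L\<^sup>2 + 1) * Q)"
      proof -
        have "(cmod (y - g))\<^sup>2 \<le> (L * D)\<^sup>2" using yg by (rule power_mono) simp
        then have "(cmod (y - g))\<^sup>2 + (cmod m1)\<^sup>2 + (cmod m2)\<^sup>2 \<le> L\<^sup>2 * D\<^sup>2 + Q"
          using zero_le_power2[of D] unfolding power_mult_distrib Q_def by linarith
        also have "\<dots> \<le> (L\<^sup>2 + 1) * Q" using mult_left_mono[OF Q0(2), of "L\<^sup>2"] by (simp add: algebra_simps)
        finally show ?thesis using s0 by (intro mult_left_mono) auto
      qed
      finally have lin: "cmod (z - g - (g - cnj g) * m1) \<le> C1 * Q" by (simp add: C1_def mult.assoc)
      have gg: "cmod (g - cnj g) = 2 * s" using g by (simp add: complex_diff_cnj norm_mult s_def)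
      have zg: "cmod (z - g) \<le> 2 * s * cmod m1 + C1 * Q"
        using norm_triangle_ineq[of "(g - cnj g) * m1" "z - g - (g - cnj g) * m1"] lin by (simp add: norm_mult gg)
      have "2 * s * cmod m1 \<le> 2 * s * (1/8)" using DQ \<eta> s0 by (intro mult_left_mono) auto
      moreover have "C1 * Q \<le> C1 * \<eta>" using C10 True \<eta>2 by (intro mult_left_mono) auto
      ultimately have "cmod (z - g) < s" using zg C1\<eta> s0 by linarith
      then have Iz: "Im z > 0" using abs_Im_le_cmod[of "z - g"] unfolding s_def minus_complex.sel by arith
      have "(cmod (z - g))\<^sup>2 \<le> (2 * s * cmod m1 + C1 * Q)\<^sup>2" using zg by (rule power_mono) simp
      also have "\<dots> \<le> 2 * (2 * s * cmod m1)\<^sup>2 + 2 * (C1 * Q)\<^sup>2"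
        using sum_squares_bound[of "2 * s * cmod m1" "C1 * Q"] by (simp add: power2_sum)
      also have "\<dots> = 8 * s\<^sup>2 * (cmod m1)\<^sup>2 + 2 * C1\<^sup>2 * (Q * Q)" by (simp add: power_mult_distrib power2_eq_square)
      \<comment> \<open>Q \<le> 1 holds in this case, so Q^2 is absorbed into Q.\<close>
      also have "\<dots> \<le> 8 * s\<^sup>2 * Q + 2 * C1\<^sup>2 * (1 * Q)"
        using Q0 True \<eta>2 \<eta>(4) by (intro add_mono mult_left_mono mult_right_mono) auto
      finally have zg2: "(cmod (z - g))\<^sup>2 \<le> (8 * s\<^sup>2 + 2 * C1\<^sup>2) * Q" by (simp add: algebra_simps)
      have "W - cayley \<alpha> g - \<kappa> * m1 = (cayley \<alpha> z - cayley \<alpha> g - b * (z - g)) + b * (z - g - (g - cnj g) * m1)"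
        using W(1)[OF Iz] by (simp add: \<kappa>_def algebra_simps)
      then have "cmod (W - cayley \<alpha> g - \<kappa> * m1) \<le> 2 / (Im \<alpha>)\<^sup>2 * (cmod (z - g))\<^sup>2 + cmod b * (C1 * Q)"
        using cayley_taylor[OF \<alpha> g Iz] lin
        by (simp only: flip: b_def) (intro order_trans[OF norm_triangle_ineq] add_mono, simp, simp only: norm_mult, intro mult_left_mono, auto)
      also have "\<dots> \<le> 2 / (Im \<alpha>)\<^sup>2 * ((8 * s\<^sup>2 + 2 * C1\<^sup>2) * Q) + cmod b * (C1 * Q)"
        using zg2 by (intro add_right_mono mult_left_mono) auto
      also have "\<dots> = Cg * Q" by (simp add: Cg_def algebra_simps)
      also have "\<dots> \<le> C * Q" using Q0 by (intro mult_right_mono) (auto simp: C_def)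
      finally show ?thesis .
    next
      case False
      have "cmod (\<Sum>j=1..n. cayley g (of_real (x j))) \<le> real n"
        using sum_norm_bound[of "{1..n}" "\<lambda>j. cayley g (of_real (x j))" 1] cmod_cayley_real[of g] g by simp
      then have "cmod m1 \<le> 1" using n by (simp add: m1_def norm_divide field_simps)
      then have "cmod (\<kappa> * m1) \<le> cmod \<kappa>" unfolding norm_mult by (intro mult_left_le) auto
      moreover have "cmod W \<le> 1" using W cmod_cayley_less_1[OF \<alpha>, of z] by (cases "Im z > 0") auto
      moreover have "cmod (cayley \<alpha> g) \<le> 1" using cmod_cayley_less_1[OF \<alpha> g] by simp
      ultimately have "cmod (W - cayley \<alpha> g - \<kappa> * m1) \<le> 2 + cmod \<kappa>"
        using norm_triangle_ineq4[of "W - cayley \<alpha> g" "\<kappa> * m1"] norm_triangle_ineq4[of W "cayley \<alpha> g"] by linarith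
      also have "\<dots> = (2 + cmod \<kappa>) / \<eta>\<^sup>2 * \<eta>\<^sup>2" using \<eta>(1) by simp
      also have "\<dots> \<le> (2 + cmod \<kappa>) / \<eta>\<^sup>2 * Q" using False by (intro mult_left_mono) auto
      also have "\<dots> \<le> C * Q" using Q0 Cg0 by (intro mult_right_mono) (auto simp: C_def)
      finally show ?thesis .
    qed
    then show "cmod (W - cayley \<alpha> g - (g - cnj g) * ((\<alpha> - cnj \<alpha>) / (g - cnj \<alpha>)\<^sup>2) *
              ((\<Sum>j=1..n. cayley g (of_real (x j))) / of_nat n))
        \<le> C * (D\<^sup>2 + (cmod ((\<Sum>j=1..n. cayley g (of_real (x j))) / of_nat n))\<^sup>2
              + (cmod ((\<Sum>j=1..n. (cayley g (of_real (x j)))\<^sup>2) / of_nat n))\<^sup>2)"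
      by (simp only: \<kappa>_def b_def m1_def m2_def Q_def)
  qed
qed

text \<open>An injective holomorphic map has a holomorphic inverse on its open image, and the
  difference quotient of that inverse is bounded near \<open>f g\<close>. Near \<open>f g\<close>
  the value of \<open>the_inv_into\<close> is that of the holomorphic inverse.\<close>

lemma inverse_locally_Lipschitz:
  fixes f :: "complex \<Rightarrow> complex"
  assumes U: "open U" and inj: "inj_on f U" and hol: "f holomorphic_on U" and g: "g \<in> U"
  obtains L \<delta> where "L \<ge> 0" "\<delta> > 0" "\<And>v. cmod (v - f g) \<le> \<delta> \<Longrightarrow> cmod (the_inv_into U f v - g) \<le> L * cmod (v - f g)"
proof -
  obtain h where h: "h holomorphic_on (f ` U)" "\<And>z. z \<in> U \<Longrightarrow> h (f z) = z"
    using holomorphic_has_inverse[OF hol U inj] by metis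
  have oU: "open (f ` U)" by (rule open_mapping_thm3[OF hol U inj])
  have "(h has_field_derivative deriv h (f g)) (at (f g))"
    using h(1) oU g by (auto intro: holomorphic_derivI)
  then have lim: "((\<lambda>v. (h v - h (f g)) / (v - f g)) \<longlongrightarrow> deriv h (f g)) (at (f g))"
    by (simp add: has_field_derivative_iff)
  define L where "L = cmod (deriv h (f g)) + 1"
  have "\<forall>\<^sub>F v in at (f g). cmod ((h v - h (f g)) / (v - f g)) < L"
    using order_tendstoD(2)[OF tendsto_norm[OF lim], of L] by (simp add: L_def)
  moreover have "\<forall>\<^sub>F v in at (f g). v \<in> f ` U"
    using oU g by (intro eventually_at_in_open') auto
  ultimately have "\<forall>\<^sub>F v in at (f g). v \<in> f ` U \<and> cmod ((h v - h (f g)) / (v - f g)) < L"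
    by eventually_elim auto
  then obtain d where d: "d > 0" "\<And>v. v \<noteq> f g \<Longrightarrow> dist v (f g) < d \<Longrightarrow> v \<in> f ` U \<and> cmod ((h v - h (f g)) / (v - f g)) < L"
    by (auto simp: eventually_at)
  show thesis
  proof
    show "L \<ge> 0" by (simp add: L_def)
    \<comment> \<open>Halving passes from the closed condition of the claim to the strict one
      supplied by the limit.\<close>
    show "d / 2 > 0" using d by simp
    fix v assume v: "cmod (v - f g) \<le> d / 2"
    show "cmod (the_inv_into U f v - g) \<le> L * cmod (v - f g)"
    proof (cases "v = f g")
      case True
      then show ?thesis using inj g by (simp add: the_inv_into_f_f)
    next
      case False
      have "dist v (f g) < d" using v d(1) by (simp add: dist_norm)
      with d(2)[OF False] have "v \<in> f ` U" and lt: "cmod ((h v - h (f g)) / (v - f g)) < L" by auto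
      then obtain z where z: "z \<in> U" "v = f z" by auto
      then have "the_inv_into U f v = h v" using inj h(2) by (simp add: the_inv_into_f_f)
      then show ?thesis using lt False h(2)[OF g] by (simp add: norm_divide field_simps)
    qed
  qed
qed

section \<open>The efficiency bound\<close>

lemma sum3_square_le:
  fixes a b c :: real
  shows "(a + b + c)\<^sup>2 \<le> 3 * (a\<^sup>2 + b\<^sup>2 + c\<^sup>2)"
proof -
  have "0 \<le> (a - b)\<^sup>2 + (a - c)\<^sup>2 + (b - c)\<^sup>2" by simp
  also have "\<dots> = 3 * (a\<^sup>2 + b\<^sup>2 + c\<^sup>2) - (a + b + c)\<^sup>2" by (simp add: power2_eq_square algebra_simps)
  finally show ?thesis by simp
qed

theorem theorem5p3:
  fixes M :: "'a measure"
    and w \<alpha> :: complex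
    and U :: "complex set"
    and f :: "complex \<Rightarrow> complex"
    and l :: real
    and Xt :: "nat \<Rightarrow> 'a \<Rightarrow> real"
    and X Y Z W :: "nat \<Rightarrow> 'a \<Rightarrow> complex"
  assumes "prob_space M"
    and "cmod w < 1"
    and "\<alpha> \<in> upper_half_plane"
    and "prob_space.indep_vars M (\<lambda>_. borel) Xt {1..}"
    and "\<And>n. n \<ge> 1 \<Longrightarrow> distributed M lborel (Xt n) (\<lambda>x. ennreal (circular_cauchy_density w x))"
    and "\<And>n \<omega>. X n \<omega> = cayley_inv \<alpha> (exp (\<i> * of_real (Xt n \<omega>)))"
    and "admissible_generator U f"
    and "l > 0"
    and "integrable M (\<lambda>\<omega>. exp (l * cmod (f (X 1 \<omega>))))"
    and "\<And>n \<omega>. Y n \<omega> = the_inv_into U f (1 / of_nat n * (\<Sum>j=1..n. f (X j \<omega>)))"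
    and "\<And>n \<omega>. Z n \<omega> = Y n \<omega> +
           2 * of_real (Im (Y n \<omega>)) * \<i> / of_nat n *
             (\<Sum>j=1..n. (X j \<omega> - Y n \<omega>) / (X j \<omega> - cnj (Y n \<omega>)))"
    and "\<And>n. n \<ge> 1 \<Longrightarrow> W n \<in> borel_measurable M"
    and "\<And>n \<omega>. n \<ge> 1 \<Longrightarrow> \<omega> \<in> space M \<Longrightarrow> Z n \<omega> \<in> upper_half_plane \<Longrightarrow> W n \<omega> = cayley \<alpha> (Z n \<omega>)"
    and "\<And>n \<omega>. n \<ge> 1 \<Longrightarrow> \<omega> \<in> space M \<Longrightarrow> Z n \<omega> \<notin> upper_half_plane \<Longrightarrow> cmod (W n \<omega>) \<le> 1"
  shows "limsup (\<lambda>n. ereal (real n * cvariance M (W n)))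
           \<le> ereal (lim (\<lambda>n. real n * (\<integral>\<omega>. (cmod (W n \<omega> - w))\<^sup>2 \<partial>M)))
         \<and> (\<lambda>n. real n * (\<integral>\<omega>. (cmod (W n \<omega> - w))\<^sup>2 \<partial>M)) \<longlonglongrightarrow> (1 - (cmod w)\<^sup>2)\<^sup>2"
proof -
  interpret prob_space M by fact
  note w = assms(2) and dist = assms(5) and Wmeas = assms(12)
  define g where "g = cayley_inv \<alpha> w"
  define \<xi> where "\<xi> t = cayley_inv \<alpha> (cis t)" for t
  have \<alpha>: "Im \<alpha> > 0" using assms(3) by (simp add: upper_half_plane_def)
  have g: "Im g > 0" using cayley_inv_mem_upper_half_plane[OF \<alpha> w] by (simp add: g_def upper_half_plane_def)
  have wg: "cayley \<alpha> g = w" unfolding g_def using \<alpha> w by (intro cayley_cayley_inv) auto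
  have X: "X n \<omega> = \<xi> (Xt n \<omega>)" for n \<omega> by (simp add: assms(6) \<xi>_def cis_conv_exp)
  \<comment> \<open>\<open>X\<close> is complex valued by type; its real part is the sample to which
    the deterministic bound is applied.\<close>
  have Xreal: "of_real (Re (X n \<omega>)) = X n \<omega>" for n \<omega>
    using cayley_inv_cis_real[of \<alpha> "Xt n \<omega>"] by (auto simp: X \<xi>_def)
  obtain a where fcont: "continuous_on (closed_upper_half_plane - {of_real a}) f"
    and fU: "closed_upper_half_plane - {of_real a} \<subseteq> U"
    and flim: "((\<lambda>z. (z - of_real a) * f z) \<longlongrightarrow> 0) (at (of_real a) within closed_upper_half_plane)"
      "((\<lambda>z. f z / of_real (cmod z)) \<longlongrightarrow> 0) (inf at_infinity (principal closed_upper_half_plane))"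
    using assms(7) by (rule admissible_generator_real_singularity)
  have uU: "upper_half_plane \<subseteq> U"
    using fU by (force simp: upper_half_plane_def closed_upper_half_plane_def)
  have gU: "g \<in> U" using uU g by (auto simp: upper_half_plane_def)
  have U: "open U" "inj_on f U" "f holomorphic_on U"
    using assms(7) by (auto simp: admissible_generator_def)
  have Xtm: "Xt n \<in> borel_measurable M" if "n \<ge> 1" for n
    using distributed_measurable[OF dist[OF that]] by simp
  \<comment> \<open>The three statistics are taken as functions of the angle, so independence and
    common law pass directly from \<open>Xt\<close>; their sample means are the quantities entering
    \<open>Q\<close>.\<close>
  define H1 where "H1 t = f (\<xi> t) - f g" for t
  define H2 where "H2 t = cayley g (\<xi> t)" for t
  define H3 where "H3 t = (cayley g (\<xi> t))\<^sup>2" for t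
  have mf: "(\<lambda>t. f (\<xi> t)) \<in> borel_measurable borel"
    unfolding \<xi>_def by (rule borel_measurable_cayley_inv_cis[OF fcont])
  have meas: "H1 \<in> borel_measurable borel" "H2 \<in> borel_measurable borel" "H3 \<in> borel_measurable borel"
    using mf cayley_power_mean(1)[OF \<alpha> w, of 1] cayley_power_mean(1)[OF \<alpha> w, of 2]
    unfolding H1_def H2_def H3_def g_def[symmetric] \<xi>_def[symmetric] by simp_all
  note tr = distributed_expectation[OF dist measurable_circular_cauchy_density circular_cauchy_density_nonneg[OF w]]
  have nH: "cmod (H2 t) = 1" "cmod (H3 t) = 1" for t
    using cayley_power_mean(2)[OF \<alpha> w, of 1 t] by (simp_all add: H2_def H3_def g_def \<xi>_def norm_power)
  have fm: "(\<lambda>\<omega>. f (X 1 \<omega>)) \<in> borel_measurable M"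
    unfolding X using measurable_compose[OF Xtm[of 1] mf] by simp
  have i4: "integrable M (\<lambda>\<omega>. cmod (f (X 1 \<omega>) - c) ^ 4)" for c
    by (rule integrable_power4_if_exponential_moment[OF fm assms(8,9)])
  have f1: "integrable M (\<lambda>\<omega>. f (X 1 \<omega>))"
    using integrable_power_le_4[of "\<lambda>\<omega>. cmod (f (X 1 \<omega>))" 1] fm i4[of 0] by (simp add: integrable_norm_iff)
  then have "integrable lborel (\<lambda>t. circular_cauchy_density w t *\<^sub>R f (\<xi> t))"
    using tr(1)[OF order_refl mf] by (simp add: X)
  then have "(\<integral>t. circular_cauchy_density w t *\<^sub>R f (\<xi> t) \<partial>lborel) = f g"
    unfolding \<xi>_def g_def using holomorphic_on_subset[OF U(3) uU]
    by (intro circular_cauchy_mean_value_half_plane[OF \<alpha> w fcont _ flim])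
  then have "expectation (\<lambda>\<omega>. f (X 1 \<omega>)) = f g"
    using tr(2)[OF order_refl mf] by (simp add: X)
  then have mean1: "expectation (\<lambda>\<omega>. H1 (Xt 1 \<omega>)) = 0"
    using f1 by (simp add: H1_def X prob_space)
  have mean2: "expectation (\<lambda>\<omega>. H2 (Xt 1 \<omega>)) = 0"
    using tr(2)[OF order_refl meas(2)] cayley_power_mean(3)[OF \<alpha> w, of 1] by (simp add: H2_def g_def \<xi>_def)
  have mean3: "expectation (\<lambda>\<omega>. H3 (Xt 1 \<omega>)) = 0"
    using tr(2)[OF order_refl meas(3)] cayley_power_mean(3)[OF \<alpha> w, of 2] by (simp add: H3_def g_def \<xi>_def)
  have iid: "indep_vars (\<lambda>_. borel) (\<lambda>j \<omega>. H (Xt j \<omega>)) {1..}"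
      "\<forall>i\<ge>1. distr M borel (\<lambda>\<omega>. H (Xt i \<omega>)) = distr M borel (\<lambda>\<omega>. H (Xt 1 \<omega>))"
    if "H \<in> borel_measurable borel" for H :: "real \<Rightarrow> complex"
    using indep_vars_compose2[OF assms(4), of "\<lambda>_. H" "\<lambda>_. borel"] that
      distributed_distr_density[OF dist that] by simp_all
  have int4: "integrable M (\<lambda>\<omega>. cmod (H1 (Xt 1 \<omega>)) ^ 4)" "integrable M (\<lambda>\<omega>. cmod (H2 (Xt 1 \<omega>)) ^ 4)"
      "integrable M (\<lambda>\<omega>. cmod (H3 (Xt 1 \<omega>)) ^ 4)"
    using i4[of "f g"] nH by (simp_all add: H1_def X)
  define mu where "mu H n \<omega> = (\<Sum>j=1..n. H (Xt j \<omega>)) / of_nat n" for H :: "real \<Rightarrow> complex" and n \<omega>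
  define k where "k H = 12 * (1 + expectation (\<lambda>\<omega>. cmod (H (Xt 1 \<omega>)) ^ 4))\<^sup>2" for H :: "real \<Rightarrow> complex"
  note mom1 = sample_mean_moments[OF iid[OF meas(1)] int4(1) mean1, folded mu_def k_def]
  note mom2 = sample_mean_moments[OF iid[OF meas(2)] int4(2) mean2, folded mu_def k_def]
  note mom3 = sample_mean_moments[OF iid[OF meas(3)] int4(3) mean3, folded mu_def k_def]
  have mmu: "mu H n \<in> borel_measurable M" if [measurable]: "H \<in> borel_measurable borel" for H n
    unfolding mu_def using Xtm by (intro borel_measurable_divide borel_measurable_sum measurable_compose[OF _ that]) auto
  define Q where "Q n \<omega> = (cmod (mu H1 n \<omega>))\<^sup>2 + (cmod (mu H2 n \<omega>))\<^sup>2 + (cmod (mu H3 n \<omega>))\<^sup>2" for n \<omega>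
  define \<kappa> where "\<kappa> = (g - cnj g) * ((\<alpha> - cnj \<alpha>) / (g - cnj \<alpha>)\<^sup>2)"
  have \<kappa>: "cmod \<kappa> = 1 - (cmod w)\<^sup>2" unfolding \<kappa>_def using one_minus_cmod_cayley_square[OF \<alpha> g] wg by simp
  obtain L \<delta> where L: "L \<ge> 0" "\<delta> > 0"
    and Lip: "\<And>v. cmod (v - f g) \<le> \<delta> \<Longrightarrow> cmod (the_inv_into U f v - g) \<le> L * cmod (v - f g)"
    by (rule inverse_locally_Lipschitz[OF U(1,2,3) gU]) (rule that)
  obtain C where C: "C \<ge> 0" and lin: "\<And>n (x :: nat \<Rightarrow> real) y z W D.
      \<lbrakk>n \<ge> 1; D \<ge> 0; D \<le> \<delta> \<Longrightarrow> cmod (y - g) \<le> L * D;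
       z = y + 2 * of_real (Im y) * \<i> / of_nat n * (\<Sum>j=1..n. (of_real (x j) - y) / (of_real (x j) - cnj y));
       Im z > 0 \<Longrightarrow> W = cayley \<alpha> z; Im z \<le> 0 \<Longrightarrow> cmod W \<le> 1\<rbrakk>
      \<Longrightarrow> cmod (W - cayley \<alpha> g - (g - cnj g) * ((\<alpha> - cnj \<alpha>) / (g - cnj \<alpha>)\<^sup>2) *
              ((\<Sum>j=1..n. cayley g (of_real (x j))) / of_nat n))
        \<le> C * (D\<^sup>2 + (cmod ((\<Sum>j=1..n. cayley g (of_real (x j))) / of_nat n))\<^sup>2
              + (cmod ((\<Sum>j=1..n. (cayley g (of_real (x j)))\<^sup>2) / of_nat n))\<^sup>2)"
    by (rule one_step_cayley_linearization[OF \<alpha> g L]) (erule that, blast)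
  have bound: "cmod ((W n \<omega> - w) - \<kappa> * mu H2 n \<omega>) \<le> C * Q n \<omega>" if n: "n \<ge> 1" and \<omega>: "\<omega> \<in> space M" for n \<omega>
  proof -
    define v where "v = 1 / of_nat n * (\<Sum>j=1..n. f (X j \<omega>))"
    have muv: "mu H1 n \<omega> = v - f g"
      using n by (simp add: mu_def H1_def v_def X sum_subtractf diff_divide_distrib)
    have "cmod (W n \<omega> - cayley \<alpha> g - (g - cnj g) * ((\<alpha> - cnj \<alpha>) / (g - cnj \<alpha>)\<^sup>2) *
              ((\<Sum>j=1..n. cayley g (of_real (Re (X j \<omega>)))) / of_nat n))
        \<le> C * ((cmod (v - f g))\<^sup>2 + (cmod ((\<Sum>j=1..n. cayley g (of_real (Re (X j \<omega>)))) / of_nat n))\<^sup>2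
              + (cmod ((\<Sum>j=1..n. (cayley g (of_real (Re (X j \<omega>))))\<^sup>2) / of_nat n))\<^sup>2)"
    proof (rule lin[OF n norm_ge_zero])
      show "cmod (v - f g) \<le> \<delta> \<Longrightarrow> cmod (Y n \<omega> - g) \<le> L * cmod (v - f g)"
        using Lip[of v] by (simp add: assms(10) v_def)
      show "Z n \<omega> = Y n \<omega> + 2 * of_real (Im (Y n \<omega>)) * \<i> / of_nat n *
          (\<Sum>j=1..n. (of_real (Re (X j \<omega>)) - Y n \<omega>) / (of_real (Re (X j \<omega>)) - cnj (Y n \<omega>)))"
        unfolding Xreal by (rule assms(11))
      show "0 < Im (Z n \<omega>) \<Longrightarrow> W n \<omega> = cayley \<alpha> (Z n \<omega>)" "Im (Z n \<omega>) \<le> 0 \<Longrightarrow> cmod (W n \<omega>) \<le> 1"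
        using assms(13,14)[OF n \<omega>] by (auto simp: upper_half_plane_def)
    qed
    then show ?thesis unfolding Xreal wg \<kappa>_def Q_def muv by (simp add: mu_def H2_def H3_def X)
  qed
  have W1: "cmod (W n \<omega>) \<le> 1" if "n \<ge> 1" "\<omega> \<in> space M" for n \<omega>
  proof (cases "Z n \<omega> \<in> upper_half_plane")
    case True
    then show ?thesis using assms(13)[OF that True] cmod_cayley_less_1[OF \<alpha>, of "Z n \<omega>"] by (simp add: upper_half_plane_def)
  next
    case False
    then show ?thesis by (rule assms(14)[OF that])
  qed
  define R where "R n \<omega> = 3 * (cmod (mu H1 n \<omega>) ^ 4 + cmod (mu H2 n \<omega>) ^ 4 + cmod (mu H3 n \<omega>) ^ 4)" for n \<omega>
  have QR: "(Q n \<omega>)\<^sup>2 \<le> R n \<omega>" for n \<omega>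
    using sum3_square_le[of "(cmod (mu H1 n \<omega>))\<^sup>2" "(cmod (mu H2 n \<omega>))\<^sup>2" "(cmod (mu H3 n \<omega>))\<^sup>2"]
    by (simp add: Q_def R_def)
  have Ri: "integrable M (R n)" if "n \<ge> 1" for n
    unfolding R_def using mom1(1)[OF that] mom2(1)[OF that] mom3(1)[OF that] by simp
  have Qm: "Q n \<in> borel_measurable M" for n
    using mmu[OF meas(1), of n] mmu[OF meas(2), of n] mmu[OF meas(3), of n] unfolding Q_def by measurable
  have Qi: "integrable M (\<lambda>\<omega>. (Q n \<omega>)\<^sup>2)" if "n \<ge> 1" for n
    by (rule Bochner_Integration.integrable_bound[OF Ri[OF that]])
      (use Qm[of n] QR in \<open>auto intro!: AE_I2 order_trans[OF QR abs_ge_self]\<close>)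
  have main: "(\<lambda>n. real n * (\<integral>\<omega>. (cmod (W n \<omega> - w))\<^sup>2 \<partial>M)) \<longlonglongrightarrow> (cmod \<kappa>)\<^sup>2"
  \<comment> \<open>In \<open>K\<close> the factor 3 comes from squaring a sum of three terms, and
    each \<open>k H\<close> is the fourth moment constant of the corresponding sample mean.\<close>
  proof (rule scaled_second_moment_tendsto[where V = "\<lambda>n \<omega>. W n \<omega> - w" and m = "mu H2" and Q = Q and K = "3 * (k H1 + k H2 + k H3)", OF _ bound C])
    show "(\<lambda>\<omega>. W n \<omega> - w) \<in> borel_measurable M" if "n \<ge> 1" for n using Wmeas[OF that] by measurable
    show "Q n \<omega> \<ge> 0" for n \<omega> by (simp add: Q_def)
    show "integrable M (\<lambda>\<omega>. (cmod (mu H2 n \<omega>))\<^sup>2)" if "n \<ge> 1" for n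
      using integrable_power_le_4[of "\<lambda>\<omega>. cmod (mu H2 n \<omega>)" 2] mom2(1)[OF that] mmu[OF meas(2), of n] by simp
    \<comment> \<open>\<open>H2\<close> has modulus exactly 1, so its second moment is 1 and the
      limit is |\<kappa>|^2 with no further factor.\<close>
    show "expectation (\<lambda>\<omega>. (cmod (mu H2 n \<omega>))\<^sup>2) = 1 / real n" if "n \<ge> 1" for n
      using mom2(2)[OF that] nH by (simp add: prob_space)
    fix n :: nat assume n: "n \<ge> 1"
    show "integrable M (\<lambda>\<omega>. (Q n \<omega>)\<^sup>2)" by (rule Qi[OF n])
    have "expectation (\<lambda>\<omega>. (Q n \<omega>)\<^sup>2) \<le> expectation (R n)"
      by (rule integral_mono[OF Qi[OF n] Ri[OF n] QR])
    also have "\<dots> \<le> 3 * (k H1 / (real n)\<^sup>2 + k H2 / (real n)\<^sup>2 + k H3 / (real n)\<^sup>2)"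
      unfolding R_def using mom1(1,3)[OF n] mom2(1,3)[OF n] mom3(1,3)[OF n] by simp
    finally show "expectation (\<lambda>\<omega>. (Q n \<omega>)\<^sup>2) \<le> 3 * (k H1 + k H2 + k H3) / (real n)\<^sup>2"
      by (simp add: add_divide_distrib)
  qed
  have "cvariance M (W n) \<le> (\<integral>\<omega>. (cmod (W n \<omega> - w))\<^sup>2 \<partial>M)" if n: "n \<ge> 1" for n
  proof (rule cvariance_le_second_moment[OF assms(1)])
    show "integrable M (W n)"
      by (rule integrable_const_bound[of _ 1]) (use W1[OF n] Wmeas[OF n] in auto)
    show "integrable M (\<lambda>\<omega>. (cmod (W n \<omega>))\<^sup>2)"
      by (rule integrable_const_bound[of _ 1]) (use W1[OF n] Wmeas[OF n] in \<open>auto simp: power_le_one\<close>)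
  qed
  then have "\<forall>\<^sub>F n in sequentially. ereal (real n * cvariance M (W n)) \<le> ereal (real n * (\<integral>\<omega>. (cmod (W n \<omega> - w))\<^sup>2 \<partial>M))"
    unfolding eventually_sequentially by (intro exI[of _ 1]) (auto intro: mult_left_mono)
  then have "limsup (\<lambda>n. ereal (real n * cvariance M (W n)))
      \<le> limsup (\<lambda>n. ereal (real n * (\<integral>\<omega>. (cmod (W n \<omega> - w))\<^sup>2 \<partial>M)))"
    by (rule Limsup_mono)
  also have "\<dots> = ereal ((cmod \<kappa>)\<^sup>2)"
    by (rule lim_imp_Limsup) (use main in auto)
  finally show ?thesis using main limI[OF main] by (simp add: \<kappa>)
qed

end
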